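(* Let $\mathbb{N}=\{0,1,2,\ldots\}$. (i) For every integer $a>1$, $$\left\{\left\lfloor\frac{x^2+y^2+z^2}{a}\right\rfloor:\ x,y,z\in\mathbb{Z}\right\}=\mathbb{N}\quad\text{and}\quad\left\{\left\lfloor\frac{x(x+1)+y(y+1)+z(z+1)}{a}\right\rfloor:\ x,y,z\in\mathbb{Z}\right\}=\mathbb{N}.$$ (ii) Let $a$ be a positive integer. If $a$ is odd, then every $n\in\mathbb{N}$ can be written as $x^2+y^2+z^2+\lfloor \frac a2(x+y+z)\rfloor$ with $x,y,z\in\mathbb{Z}$. If $3\nmid a$, then every $n\in\mathbb{N}$ can be written as $x^2+y^2+z^2+\lfloor\frac a3(x+y+z)\rfloor$ with $x,y,z\in\mathbb{Z}$. (iii) For every $n\in\mathbb{N}$ there are $x,y,z\in\mathbb{Z}$ such that $$n=\frac{p_8(x)}{2}+\left\lceil\frac{p_8(y)}{2}\right\rceil+\left\lceil\frac{p_8(z)}{2}\right\rceil.$$ Hence $\{s(x)+s(y)+s(z):\ x,y,z\in\mathbb{Z}\}=\mathbb{N}$, where $s(x):=\lceil p_8(-x)/2\rceil=x+\lceil 1.5x^2\rceil$.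
   Context: For $x\in\mathbb{Z}$, $p_8(x)=x(3x-2)$ (generalized octagonal numbers). $\lfloor\cdot\rfloor$ and $\lceil\cdot\rceil$ denote the floor and ceiling functions. *)

theory Defs
  imports Complex_Main
begin

definition p8 :: "int \<Rightarrow> int" where
  "p8 x = x * (3 * x - 2)"

definition s :: "int \<Rightarrow> int" where
  "s x = \<lceil>real_of_int (p8 (- x)) / 2\<rceil>"

end

theory Submission
  imports Defs "HOL-Number_Theory.Number_Theory" "HOL-Computational_Algebra.Squarefree"
begin

text \<open>
  All parts reduce to the Gauss--Legendre theorem that every \<open>n \<ge> 0\<close> with
  \<open>n mod 8 \<in> {1, 2, 3, 5, 6}\<close> is a sum of three squares: completing squares turns each expression
  into a sum of three squares with congruence conditions modulo 2 and 3, and among the numbers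
  admissible for a given \<open>n\<close> at least one lies in a good residue class modulo 8.

  For the Gauss--Legendre theorem one may take \<open>n\<close> squarefree. Choose a prime \<open>q\<close> with
  \<open>q mod 4 = 1\<close> such that \<open>Q = q\<close> (or \<open>Q = 2 * q\<close> if \<open>n mod 8 = 3\<close>) satisfies: \<open>- Q\<close> is a square
  modulo \<open>n\<close>. By quadratic reciprocity \<open>n\<close> is then a square modulo \<open>Q\<close>, so a pigeonhole argument
  in a lattice of index \<open>n * Q\<close> represents \<open>n * W\<^sup>2\<close> as \<open>X\<^sup>2 + Q * T\<^sup>2\<close> with \<open>W > 0\<close>. As \<open>Q\<close> is a sum
  of two squares, \<open>n\<close> is a sum of three rational squares, hence of three integer squares by the
  descent of Davenport and Cassels.

  Only finitely many Legendre symbols of \<open>q\<close> are prescribed, so instead of Dirichlet's theorem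
  it suffices to know that \<open>\<Sum>m\<le>x. \<chi> m * \<Lambda> m / m\<close> is bounded for the nontrivial
  real characters \<open>\<chi>\<close>, which follows by Mertens' method from \<open>L(1, \<chi>) \<noteq> 0\<close>.
\<close>

section \<open>Chebyshev and Mertens estimates\<close>

text \<open>The choice of \<open>Q\<close> is forced by a product formula. Asking that
  \<open>- Q\<close> be a square modulo each odd prime \<open>p dvd n\<close> fixes
  \<open>Legendre q p\<close>, and since \<open>q mod 4 = 1\<close> it also fixes
  \<open>Legendre p q\<close>; the product over these \<open>p\<close> must then agree with
  \<open>Legendre n q = 1\<close>. For odd \<open>n\<close> and \<open>Q = q\<close> that product is
  the symbol of -1 over \<open>n\<close>, equal to 1 only if \<open>n mod 4 = 1\<close>. For
  \<open>Q = 2 * q\<close> it is the symbol of -2, which is 1 at \<open>n mod 8 = 3\<close> but -1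
  at \<open>n mod 8 = 7\<close>, where no representation exists. For even \<open>n\<close> the free
  symbol \<open>Legendre 2 q\<close> repairs the sign. Prescribing symbols rather than a residue
  class involves only characters with values in -1, 0, 1. Their divisor sums are nonnegative, which
  is what the elementary nonvanishing argument lives on. The three-squares theorem gives no control
  modulo 3, yet the completed squares \<open>(6 * x + a) ^ 2\<close> and
  \<open>(3 * x - 1) ^ 2\<close> need roots prime to 3; this is why representations of multiples of
  3 are improved near the end.\<close>

lemma abel_identity:
  fixes a b :: "nat \<Rightarrow> real"
  assumes "m \<le> n"
  shows "(\<Sum>k=m..<n. a k * b k) =
    sum a {m..<n} * b n + (\<Sum>k=m..<n. sum a {m..<Suc k} * (b k - b (Suc k)))"
  using assms
proof (induction n rule: dec_induct)
  case base
  show ?case by simp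
next
  case (step n)
  then show ?case by (simp add: algebra_simps)
qed

lemma abel_bound:
  fixes a b :: "nat \<Rightarrow> real"
  assumes part: "\<And>n. \<bar>sum a {m..<n}\<bar> \<le> B"
    and dec: "\<And>k. m \<le> k \<Longrightarrow> b (Suc k) \<le> b k" and nonneg: "\<And>k. m \<le> k \<Longrightarrow> 0 \<le> b k"
  shows "\<bar>\<Sum>k=m..<n. a k * b k\<bar> \<le> B * b m"
proof (cases "m \<le> n")
  case False
  then show ?thesis using part[of m] nonneg[of m] by simp
next
  case True
  have "\<bar>\<Sum>k=m..<n. a k * b k\<bar> \<le>
      \<bar>sum a {m..<n} * b n\<bar> + (\<Sum>k=m..<n. \<bar>sum a {m..<Suc k} * (b k - b (Suc k))\<bar>)"
    unfolding abel_identity[OF True, of a b]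
    by (rule order_trans[OF abs_triangle_ineq add_left_mono[OF sum_abs]])
  also have "\<dots> \<le> B * b n + (\<Sum>k=m..<n. B * (b k - b (Suc k)))"
  proof (rule add_mono[OF _ sum_mono])
    show "\<bar>sum a {m..<n} * b n\<bar> \<le> B * b n"
      unfolding abs_mult using mult_right_mono[OF part nonneg[OF True], of n] nonneg[OF True] by simp
    fix k assume "k \<in> {m..<n}"
    then have "0 \<le> b k - b (Suc k)" using dec by simp
    then show "\<bar>sum a {m..<Suc k} * (b k - b (Suc k))\<bar> \<le> B * (b k - b (Suc k))"
      unfolding abs_mult using mult_right_mono[OF part, of "b k - b (Suc k)" "Suc k"] by (simp only: abs_of_nonneg)
  qed
  also have "(\<Sum>k=m..<n. B * (b k - b (Suc k))) = B * (b m - b n)"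
    using sum_Suc_diff'[OF True, of b]
    by (simp add: sum_distrib_left[symmetric] sum_subtractf)
  finally show ?thesis by (simp add: algebra_simps)
qed

section \<open>Divisor sums of completely multiplicative functions\<close>

lemma divisors_mult_bij_betw:
  fixes a b :: nat
  assumes "coprime a b"
  shows "bij_betw (\<lambda>(x, y). x * y) ({d. d dvd a} \<times> {d. d dvd b}) {d. d dvd a * b}"
proof (rule bij_betwI')
  fix x y assume "x \<in> {d. d dvd a} \<times> {d. d dvd b}" "y \<in> {d. d dvd a} \<times> {d. d dvd b}"
  then obtain x1 x2 y1 y2 where [simp]: "x = (x1, x2)" "y = (y1, y2)"
    and d: "x1 dvd a" "x2 dvd b" "y1 dvd a" "y2 dvd b" by auto
  have c: "coprime x1 y2" "coprime y1 x2"
    using coprime_divisors[OF d(1,4) assms] coprime_divisors[OF d(3,2) assms] .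
  have "x1 = y1 \<and> x2 = y2" if e: "x1 * x2 = y1 * y2"
  proof -
    have "x1 dvd y1 * y2" "y1 dvd x1 * x2" "x2 dvd y1 * y2" "y2 dvd x1 * x2"
      using e dvd_triv_left[of x1 x2] dvd_triv_right[of x2 x1]
        dvd_triv_left[of y1 y2] dvd_triv_right[of y2 y1] by simp_all
    with c have "x1 dvd y1" "y1 dvd x1" "x2 dvd y2" "y2 dvd x2"
      by (simp_all add: coprime_dvd_mult_left_iff coprime_dvd_mult_right_iff coprime_commute)
    then show ?thesis by (simp add: dvd_antisym)
  qed
  then show "((case x of (x, y) \<Rightarrow> x * y) = (case y of (x, y) \<Rightarrow> x * y)) = (x = y)"
    by auto
next
  fix x assume "x \<in> {d. d dvd a} \<times> {d. d dvd b}"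
  then show "(case x of (x, y) \<Rightarrow> x * y) \<in> {d. d dvd a * b}" by (auto intro: mult_dvd_mono)
next
  fix y assume "y \<in> {d. d dvd a * b}"
  then show "\<exists>x\<in>{d. d dvd a} \<times> {d. d dvd b}. y = (case x of (x, y) \<Rightarrow> x * y)"
    using division_decomp[of y a b] by force
qed

lemma sum_divisors_mult:
  fixes f :: "nat \<Rightarrow> real"
  assumes "coprime a b" and "\<And>m n. f (m * n) = f m * f n"
  shows "(\<Sum>d | d dvd a * b. f d) = (\<Sum>d | d dvd a. f d) * (\<Sum>d | d dvd b. f d)"
proof -
  have "(\<Sum>d | d dvd a * b. f d) = (\<Sum>(x, y) \<in> {d. d dvd a} \<times> {d. d dvd b}. f x * f y)"
    by (subst sum.reindex_bij_betw[OF divisors_mult_bij_betw[OF assms(1)], symmetric])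
      (simp add: assms(2) case_prod_unfold)
  then show ?thesis by (simp add: sum_product sum.cartesian_product)
qed

lemma sum_divisors_prime_power:
  fixes f :: "nat \<Rightarrow> real"
  assumes "prime p" "f 1 = 1" and "\<And>m n. f (m * n) = f m * f n"
  shows "(\<Sum>d | d dvd p ^ k. f d) = (\<Sum>i\<le>k. f p ^ i)"
proof -
  have "{d. d dvd p ^ k} = (\<lambda>i. p ^ i) ` {..k}"
    using divides_primepow_nat[OF assms(1)] by (auto simp: le_imp_power_dvd)
  moreover have "inj_on (\<lambda>i. p ^ i) {..k}"
    using prime_gt_1_nat[OF assms(1)] by (auto simp: inj_on_def)
  moreover have "f (p ^ i) = f p ^ i" for i
    using assms by (induction i) auto
  ultimately show ?thesis by (simp add: sum.reindex)
qed

text \<open>Write \<open>ln m\<close> as the sum of \<open>mangoldt d\<close> over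
  \<open>d dvd m\<close> and interchange the sums. With \<open>g = 1\<close> this factors
  \<open>n!\<close>; with \<open>g m = \<chi> m / m\<close> the inner sums become partial sums of
  L(1, \<open>\<chi>\<close>).\<close>

lemma sum_ln_eq_sum_mangoldt:
  fixes g :: "nat \<Rightarrow> real"
  shows "(\<Sum>m=1..n. g m * ln (real m)) = (\<Sum>d=1..n. mangoldt d * (\<Sum>k=1..n div d. g (d * k)))"
proof -
  have "(\<Sum>m=1..n. g m * ln (real m)) = (\<Sum>m=1..n. \<Sum>d | d \<in> {1..n} \<and> d dvd m. g m * mangoldt d)"
  proof (intro sum.cong refl)
    fix m assume m: "m \<in> {1..n}"
    then have "{d. d \<in> {1..n} \<and> d dvd m} = {d. d dvd m}"
      by (auto dest: dvd_imp_le intro: Nat.gr0I)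
    then show "g m * ln (real m) = (\<Sum>d | d \<in> {1..n} \<and> d dvd m. g m * mangoldt d)"
      using m mangoldt_sum[of m, where ?'a=real] by (simp add: sum_distrib_left[symmetric])
  qed
  also have "\<dots> = (\<Sum>d=1..n. \<Sum>m | m \<in> {1..n} \<and> d dvd m. g m * mangoldt d)"
    by (rule sum.swap_restrict) auto
  also have "\<dots> = (\<Sum>d=1..n. mangoldt d * (\<Sum>k=1..n div d. g (d * k)))"
  proof (intro sum.cong refl)
    fix d assume d: "d \<in> {1..n}"
    have "bij_betw (\<lambda>k. d * k) {1..n div d} {m. m \<in> {1..n} \<and> d dvd m}"
      using d by (intro bij_betwI[where g="\<lambda>m. m div d"])
        (auto simp: less_eq_div_iff_mult_less_eq mult.commute elim!: dvdE)
    from sum.reindex_bij_betw[OF this, of "\<lambda>m. g m * mangoldt d"]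
    show "(\<Sum>m | m \<in> {1..n} \<and> d dvd m. g m * mangoldt d) = mangoldt d * (\<Sum>k=1..n div d. g (d * k))"
      by (simp add: sum_distrib_left mult.commute)
  qed
  finally show ?thesis .
qed

lemma sum_ln_eq_ln_fact: "(\<Sum>m=1..n. ln (real m)) = ln (fact n)"
  by (induction n) (simp_all add: ln_mult del: of_nat_Suc)

lemma ln_fact_eq_sum_mangoldt: "ln (fact n) = (\<Sum>d=1..n. mangoldt d * real (n div d))"
  using sum_ln_eq_sum_mangoldt[of "\<lambda>_. 1" n] sum_ln_eq_ln_fact[of n] by simp

text \<open>The central binomial coefficient is at most \<open>4 ^ n\<close>, and in its logarithm
  each \<open>mangoldt m\<close> has the nonnegative coefficient
  \<open>2 * n div m - 2 * (n div m)\<close>, which is at least 1 for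
  \<open>n < m \<le> 2 * n\<close>.\<close>

lemma chebyshev_psi_double:
  "(\<Sum>m=1..2*n. mangoldt m) \<le> (\<Sum>m=1..n. mangoldt m) + real n * ln (4::real)"
proof -
  have "(\<Sum>m=1..2*n. mangoldt m) - (\<Sum>m=1..n. mangoldt m) = (\<Sum>m\<in>{1..2*n}-{1..n}. mangoldt m :: real)"
    by (subst sum_diff) auto
  also have "\<dots> \<le> (\<Sum>m\<in>{1..2*n}-{1..n}. mangoldt m * (real (2 * n div m) - 2 * real (n div m)))"
  proof (intro sum_mono)
    fix m assume m: "m \<in> {1..2*n}-{1..n}"
    then have "n div m = 0" "2 * n div m \<ge> 1"
      by (auto simp: Suc_le_eq div_greater_zero_iff)
    then show "mangoldt m \<le> mangoldt m * (real (2 * n div m) - 2 * real (n div m))"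
      using mult_left_mono[OF _ mangoldt_nonneg, of 1 "real (2 * n div m)" m] by simp
  qed
  also have "\<dots> \<le> (\<Sum>m=1..2*n. mangoldt m * (real (2 * n div m) - 2 * real (n div m)))"
  proof (intro sum_mono2 mult_nonneg_nonneg mangoldt_nonneg)
    fix m
    have "2 * (n div m) \<le> 2 * n div m"
      by (cases "m = 0") (simp_all add: less_eq_div_iff_mult_less_eq)
    then show "0 \<le> real (2 * n div m) - 2 * real (n div m)" by linarith
  qed auto
  also have "\<dots> = ln (fact (2 * n)) - 2 * (\<Sum>m=1..2*n. mangoldt m * real (n div m))"
    unfolding ln_fact_eq_sum_mangoldt
    by (simp add: algebra_simps sum_subtractf sum_distrib_left)
  also have "(\<Sum>m=1..2*n. mangoldt m * real (n div m)) = ln (fact n)"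
    unfolding ln_fact_eq_sum_mangoldt
    by (intro sum.mono_neutral_right) auto
  also have "ln (fact (2 * n)) - 2 * ln (fact n) = ln (real ((2 * n) choose n))"
  proof -
    have "real ((2 * n) choose n) = fact (2 * n) / (fact n * fact n)"
      using binomial_fact[of n "2 * n", where ?'a=real] by (simp add: mult_2)
    then show ?thesis by (simp only: ln_div ln_mult mult_2) simp
  qed
  also have "\<dots> \<le> ln (4 ^ n)"
  proof (subst ln_le_cancel_iff)
    have "real ((2 * n) choose n) \<le> real (2 ^ (2 * n))"
      by (rule of_nat_mono[OF binomial_le_pow2])
    also have "\<dots> = 4 ^ n" by (simp add: power_mult)
    finally show "real ((2 * n) choose n) \<le> 4 ^ n" .
  qed auto
  finally show ?thesis by (simp add: ln_realpow algebra_simps)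
qed

text \<open>Round \<open>n\<close> up to \<open>2 * k\<close> and halve. Induction gives
  \<open>4 * k\<close>, doubling adds \<open>k * ln 4 \<le> 2 * k\<close>, and
  \<open>6 * k \<le> 4 * n\<close> holds from \<open>n = 2\<close> on, with equality at
  \<open>n = 3\<close>.\<close>

lemma chebyshev_psi_upper: "(\<Sum>m=1..n. mangoldt m) \<le> 4 * real n"
proof (induction n rule: less_induct)
  case (less n)
  define k where "k = (n + 1) div 2"
  show ?case
  proof (cases "n \<le> 1")
    case True
    then show ?thesis by (cases n) auto
  next
    case False
    have l: "ln (4::real) \<le> 2"
      using ln_realpow[of "2::real" 2] ln_2_less_1 by simp
    have "(\<Sum>m=1..n. mangoldt m) \<le> (\<Sum>m=1..2*k. mangoldt m :: real)"
      unfolding k_def by (intro sum_mono2) (auto simp: mangoldt_nonneg)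
    also have "\<dots> \<le> (\<Sum>m=1..k. mangoldt m) + real k * ln 4" by (rule chebyshev_psi_double)
    also have "\<dots> \<le> 4 * real k + real k * 2"
      using False l unfolding k_def by (intro add_mono less.IH mult_left_mono) auto
    also have "\<dots> \<le> 4 * real n"
    proof -
      have "6 * k \<le> 4 * n" using False unfolding k_def by presburger
      then show ?thesis by linarith
    qed
    finally show ?thesis .
  qed
qed

text \<open>Compare \<open>ln (fact n) \<ge> n * ln n - n\<close> with its expansion in
  \<open>mangoldt\<close>, after dropping the rounding in \<open>n div d\<close>. Only this half of
  Mertens' estimate matters: it supplies the divergence.\<close>

lemma mertens_lower: "n \<ge> 1 \<Longrightarrow> ln (real n) - 1 \<le> (\<Sum>m=1..n. mangoldt m / real m)"
proof -
  assume n: "n \<ge> 1"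
  have "real n * ln (real n) - real n \<le> ln (fact n)"
  proof (induction n)
    case (Suc n)
    show ?case
    proof (cases "n = 0")
      case False
      have "ln (1 + 1 / real n) \<le> 1 / real n" by (rule ln_add_one_self_le_self) simp
      moreover have "1 + 1 / real n = real (Suc n) / real n" using False by (simp add: field_simps)
      ultimately have "ln (real (Suc n)) - ln (real n) \<le> 1 / real n"
        using False by (simp add: ln_div)
      then have "real n * ln (real (Suc n)) - real n * ln (real n) \<le> 1"
        using False by (simp add: field_simps)
      moreover have "ln (fact (Suc n)) = ln (real (Suc n)) + ln (fact n)"
        by (simp add: ln_mult del: of_nat_Suc)
      ultimately show ?thesis using Suc by (simp add: algebra_simps)
    qed simp
  qed simp
  also have "ln (fact n) \<le> (\<Sum>m=1..n. mangoldt m * (real n / real m))"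
    unfolding ln_fact_eq_sum_mangoldt
    by (intro sum_mono mult_left_mono mangoldt_nonneg of_nat_div_le_of_nat)
  also have "\<dots> = real n * (\<Sum>m=1..n. mangoldt m / real m)"
    by (simp add: sum_distrib_left mult.commute)
  finally have "real n * (ln (real n) - 1) \<le> real n * (\<Sum>m=1..n. mangoldt m / real m)"
    by (simp add: algebra_simps)
  then show ?thesis using n by simp
qed

lemma split_off_prime_power:
  fixes n :: nat
  assumes "1 < n"
  obtains p k m where "prime p" "n = p ^ k * m" "coprime (p ^ k) m" "0 < m" "m < n"
proof -
  obtain p where p: "prime p" "p dvd n" using prime_factor_nat[of n] assms by auto
  obtain m where m: "n = p ^ multiplicity p n * m" "\<not> p dvd m"
    by (rule multiplicity_decompose'[of n p]) (use p assms in auto)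
  have "multiplicity p n > 0" using p assms by (simp add: prime_multiplicity_gt_zero_iff)
  then have "p ^ multiplicity p n > 1" using prime_gt_1_nat[OF p(1)] by (intro one_less_power)
  moreover have "m > 0" using m assms by (intro Nat.gr0I) auto
  ultimately have "m < n" by (subst m(1)) simp
  moreover have "coprime (p ^ multiplicity p n) m"
    using m p by (simp add: prime_imp_coprime)
  ultimately show ?thesis using that[OF p(1) m(1)] \<open>m > 0\<close> by blast
qed

section \<open>Real characters\<close>

text \<open>Periodicity enters the analysis only through the boundedness of the partial sums.\<close>

locale real_character =
  fixes \<chi> :: "nat \<Rightarrow> real" and B :: real
  assumes one [simp]: "\<chi> 1 = 1"
    and mult: "\<chi> (m * n) = \<chi> m * \<chi> n"
    and vals: "\<chi> n \<in> {-1, 0, 1}"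
    and bounded: "\<bar>\<Sum>k=1..<n. \<chi> k\<bar> \<le> B"
begin

lemma abs_le_1: "\<bar>\<chi> n\<bar> \<le> 1"
  using vals[of n] by auto

lemma B_nonneg: "0 \<le> B"
  using bounded[of 0] by simp

lemma bounded_interval:
  assumes "1 \<le> m"
  shows "\<bar>\<Sum>k=m..<n. \<chi> k\<bar> \<le> 2 * B"
proof (cases "m \<le> n")
  case True
  have "(\<Sum>k=1..<n. \<chi> k) = (\<Sum>k=1..<m. \<chi> k) + (\<Sum>k=m..<n. \<chi> k)"
    using True assms by (simp add: sum.atLeastLessThan_concat)
  then show ?thesis using bounded[of n] bounded[of m] by linarith
qed (use B_nonneg in simp)

lemma weighted_sum_bound:
  fixes b :: "nat \<Rightarrow> real"
  assumes "1 \<le> m" "\<And>k. m \<le> k \<Longrightarrow> b (Suc k) \<le> b k" "\<And>k. m \<le> k \<Longrightarrow> 0 \<le> b k"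
  shows "\<bar>\<Sum>k=m..<n. \<chi> k * b k\<bar> \<le> 2 * B * b m"
  using assms by (intro abel_bound bounded_interval)

definition L_partial :: "nat \<Rightarrow> real" where "L_partial n = (\<Sum>k=1..n. \<chi> k / real k)"

lemma L_partial_diff: "m \<le> n \<Longrightarrow> \<bar>L_partial n - L_partial m\<bar> \<le> 2 * B / real (m + 1)"
proof -
  assume "m \<le> n"
  then have "L_partial n = L_partial m + (\<Sum>k=m+1..<n+1. \<chi> k * (1 / real k))"
    unfolding L_partial_def
    by (induction n rule: dec_induct) (simp_all add: field_simps del: of_nat_Suc)
  moreover have "\<bar>\<Sum>k=m+1..<n+1. \<chi> k * (1 / real k)\<bar> \<le> 2 * B * (1 / real (m + 1))"
    by (rule weighted_sum_bound) (auto simp: frac_le)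
  ultimately show ?thesis by simp
qed

definition L1 :: real where "L1 = lim L_partial"

lemma L_partial_tendsto: "L_partial \<longlonglongrightarrow> L1"
proof -
  have "Cauchy L_partial"
  proof (rule metric_CauchyI)
    fix e :: real assume "e > 0"
    obtain M where M: "2 * B / e < real M" using reals_Archimedean2 by blast
    have "dist (L_partial m) (L_partial n) < e" if "M \<le> m" "m \<le> n" for m n
    proof -
      have "2 * B < real (m + 1) * e"
      proof -
        have "2 * B < real M * e" using M \<open>e > 0\<close> by (simp add: field_simps)
        also have "\<dots> \<le> real (m + 1) * e" using that \<open>e > 0\<close> by (intro mult_right_mono) auto
        finally show ?thesis .
      qed
      then have "2 * B / real (m + 1) < e" by (simp add: field_simps)
      then show ?thesis using L_partial_diff[OF that(2)] by (simp add: dist_real_def abs_minus_commute)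
    qed
    then show "\<exists>M. \<forall>m\<ge>M. \<forall>n\<ge>M. dist (L_partial m) (L_partial n) < e"
      by (metis dist_commute nat_le_linear)
  qed
  then show ?thesis unfolding L1_def by (simp add: Cauchy_convergent convergent_LIMSEQ_iff[symmetric])
qed

text \<open>The rate \<open>1 / m\<close> is essential: summed against \<open>mangoldt\<close>, it
  leaves an error that Chebyshev's bound keeps constant.\<close>

lemma L1_diff: "\<bar>L1 - L_partial m\<bar> \<le> 2 * B / real (m + 1)"
proof -
  have "(\<lambda>n. \<bar>L_partial n - L_partial m\<bar>) \<longlonglongrightarrow> \<bar>L1 - L_partial m\<bar>"
    by (intro tendsto_intros L_partial_tendsto)
  then show ?thesis
    by (rule LIMSEQ_le_const2) (use L_partial_diff in blast)
qed

section \<open>Divisor sums of a real character\<close>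

definition divisor_sum :: "nat \<Rightarrow> real" where "divisor_sum n = (\<Sum>d | d dvd n. \<chi> d)"

lemma divisor_sum_mult: "coprime a b \<Longrightarrow> divisor_sum (a * b) = divisor_sum a * divisor_sum b"
  unfolding divisor_sum_def by (rule sum_divisors_mult) (auto simp: mult)

lemma divisor_sum_prime_power: "prime p \<Longrightarrow> divisor_sum (p ^ k) = (\<Sum>i\<le>k. \<chi> p ^ i)"
  unfolding divisor_sum_def using one mult by (intro sum_divisors_prime_power)

lemma alternating_sum: "(\<Sum>i\<le>k. (- 1) ^ i :: real) = (if even k then 1 else 0)"
  by (induction k) auto

lemma divisor_sum_prime_power_nonneg: "prime p \<Longrightarrow> 0 \<le> divisor_sum (p ^ k)"
  using vals[of p] by (auto simp: divisor_sum_prime_power alternating_sum sum_nonneg)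

lemma divisor_sum_prime_power_even: "prime p \<Longrightarrow> 1 \<le> divisor_sum (p ^ (2 * k))"
proof -
  assume p: "prime p"
  \<comment> \<open>This serves the case \<open>\<chi> p = 0\<close>, where only
    \<open>0 ^ 0 = 1\<close> survives.\<close>
  have "(\<Sum>i\<le>2*k. 0 ^ i) = (1::real)" by (induction k) auto
  then show "1 \<le> divisor_sum (p ^ (2 * k))"
    using vals[of p] by (auto simp: divisor_sum_prime_power[OF p] alternating_sum)
qed

lemma divisor_sum_nonneg: "0 \<le> divisor_sum n"
proof (induction n rule: less_induct)
  case (less n)
  consider "n = 0" | "n = 1" | "n > 1" by linarith
  then show ?case
  proof cases
    case 1
    \<comment> \<open>A sum over an infinite set has the default value 0.\<close>
    have "infinite {d::nat. d dvd 0}" by simp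
    then show ?thesis unfolding divisor_sum_def 1 by simp
  next
    case 3
    then obtain p k m where p: "prime p" and n: "n = p ^ k * m" and m: "coprime (p ^ k) m" "m < n"
      by (rule split_off_prime_power)
    then have "0 \<le> divisor_sum (p ^ k) * divisor_sum m"
      using less.IH divisor_sum_prime_power_nonneg by simp
    then show ?thesis unfolding n using divisor_sum_mult[OF m(1)] by simp
  qed (use one in \<open>simp add: divisor_sum_def\<close>)
qed

lemma divisor_sum_square: "n > 0 \<Longrightarrow> 1 \<le> divisor_sum (n ^ 2)"
proof (induction n rule: less_induct)
  case (less n)
  consider "n = 1" | "n > 1" using less.prems by linarith
  then show ?case
  proof cases
    case 2
    then obtain p k m where p: "prime p" and n: "n = p ^ k * m"
      and m: "coprime (p ^ k) m" "0 < m" "m < n"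
      by (rule split_off_prime_power)
    have "n ^ 2 = p ^ (2 * k) * m ^ 2"
      by (simp add: n power_mult_distrib power_mult[symmetric] mult.commute)
    moreover have "coprime (p ^ (2 * k)) (m ^ 2)"
      using m(1) by (cases "k = 0") (simp_all add: coprime_power_left_iff coprime_power_right_iff)
    ultimately have "divisor_sum (n ^ 2) = divisor_sum (p ^ (2 * k)) * divisor_sum (m ^ 2)" by (simp add: divisor_sum_mult)
    moreover have "1 * 1 \<le> divisor_sum (p ^ (2 * k)) * divisor_sum (m ^ 2)"
      using divisor_sum_prime_power_even[OF p, of k] less.IH[OF m(3,2)] by (intro mult_mono) auto
    ultimately show ?thesis by simp
  qed (use one in \<open>simp add: divisor_sum_def\<close>)
qed

lemma sum_divisor_sum_lower: "real k \<le> (\<Sum>n=1..k^2. divisor_sum n)"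
proof -
  have "real k \<le> (\<Sum>n=1..k. divisor_sum (n ^ 2))"
    using sum_mono[of "{1..k}" "\<lambda>_. 1" "\<lambda>n. divisor_sum (n ^ 2)"] divisor_sum_square by simp
  also have "\<dots> = (\<Sum>n\<in>(\<lambda>n. n ^ 2) ` {1..k}. divisor_sum n)"
    by (subst sum.reindex) (auto simp: inj_on_def)
  also have "\<dots> \<le> (\<Sum>n=1..k^2. divisor_sum n)"
    by (intro sum_mono2) (auto simp: divisor_sum_nonneg intro: power_mono)
  finally show ?thesis .
qed

end

text \<open>
  Monsky's proof that \<open>L(1, \<chi>) \<noteq> 0\<close>: the weights \<open>1 / n - x ^ n / (1 + x + \<dots> + x ^ (n - 1))\<close> decrease in
  \<open>n\<close>, so if \<open>L(1, \<chi>) = 0\<close> then the Lambert series \<open>\<Sum>n. \<chi> n * x ^ n / (1 - x ^ n)\<close> stays bounded as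
  \<open>x \<rightarrow> 1\<close>. But its power series coefficients are the nonnegative sums of \<open>\<chi>\<close> over the divisors of
  \<open>n\<close>, which are at least 1 at squares.
\<close>

lemma sum_power_ge:
  fixes y :: real
  assumes "0 \<le> y"
  shows "real n * y ^ (n - 1) \<le> (\<Sum>i<n. (y ^ 2) ^ i)"
proof -
  \<comment> \<open>Pair the sum with its reversal: by the inequality of the means each pair is at
    least twice the middle power \<open>y ^ (n - 1)\<close>.\<close>
  have "2 * (\<Sum>i<n. (y ^ 2) ^ i) = (\<Sum>i<n. (y ^ 2) ^ i) + (\<Sum>i<n. (y ^ 2) ^ (n - Suc i))"
    by (simp add: sum.nat_diff_reindex)
  also have "\<dots> = (\<Sum>i<n. (y ^ 2) ^ i + (y ^ 2) ^ (n - Suc i))" by (simp add: sum.distrib)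
  also have "\<dots> \<ge> (\<Sum>i<n. 2 * y ^ (n - 1))"
  proof (intro sum_mono)
    fix i assume i: "i \<in> {..<n}"
    have "2 * (y ^ i * y ^ (n - Suc i)) \<le> (y ^ i) ^ 2 + (y ^ (n - Suc i)) ^ 2"
      using sum_squares_bound[of "y ^ i" "y ^ (n - Suc i)"] by simp
    moreover have "y ^ i * y ^ (n - Suc i) = y ^ (n - 1)"
      using i by (simp add: power_add[symmetric])
    ultimately show "2 * y ^ (n - 1) \<le> (y ^ 2) ^ i + (y ^ 2) ^ (n - Suc i)"
      by (simp add: power_mult[symmetric] mult.commute)
  qed
  finally show ?thesis by (simp add: algebra_simps)
qed

text \<open>Consecutive values of \<open>x ^ n / \<sigma> n\<close> differ by
  \<open>x ^ n / (\<sigma> n * \<sigma> (Suc n))\<close>, those of \<open>1 / n\<close> by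
  \<open>1 / (n * (n + 1))\<close>. Monotonicity is thus
  \<open>n * (n + 1) * x ^ n \<le> \<sigma> n * \<sigma> (Suc n)\<close>; the bound of
  \<open>sum_power_ge\<close> at \<open>y = sqrt x\<close> on both factors yields the power
  \<open>y ^ (2 * n - 1)\<close>, which exceeds \<open>x ^ n\<close>.\<close>

lemma monsky_weight_decreasing:
  fixes x :: real
  assumes x: "0 < x" "x < 1" and n: "1 \<le> n"
  defines "\<sigma> \<equiv> \<lambda>n. \<Sum>i<n. x ^ i"
  shows "1 / real (Suc n) - x ^ Suc n / \<sigma> (Suc n) \<le> 1 / real n - x ^ n / \<sigma> n"
    and "0 \<le> 1 / real n - x ^ n / \<sigma> n"
proof -
  define y where "y = sqrt x"
  have y: "0 < y" "y < 1" "y ^ 2 = x" using x by (auto simp: y_def)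
  have \<sigma>_ge: "real k * y ^ (k - 1) \<le> \<sigma> k" for k
    unfolding \<sigma>_def y(3)[symmetric] using sum_power_ge[of y k] y by simp
  have pos: "0 < \<sigma> n" "0 < \<sigma> (Suc n)"
    using less_le_trans[OF _ \<sigma>_ge, of 0 n] less_le_trans[OF _ \<sigma>_ge, of 0 "Suc n"] n y by simp_all
  have "real n * real (Suc n) * x ^ n \<le> real n * real (Suc n) * (y ^ (n - 1) * y ^ n)"
  proof (rule mult_left_mono)
    have "x ^ n = y ^ (n + n)" using y(3) by (simp add: power_add power2_eq_square power_mult_distrib[symmetric])
    also have "\<dots> \<le> y ^ (n - 1 + n)" using y by (intro power_decreasing) auto
    finally show "x ^ n \<le> y ^ (n - 1) * y ^ n" by (simp add: power_add)
  qed simp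
  also have "\<dots> = (real n * y ^ (n - 1)) * (real (Suc n) * y ^ (Suc n - 1))" by simp
  also have "\<dots> \<le> \<sigma> n * \<sigma> (Suc n)"
    using \<sigma>_ge[of n] \<sigma>_ge[of "Suc n"] y pos by (intro mult_mono) auto
  finally have key: "real n * real (Suc n) * x ^ n \<le> \<sigma> n * \<sigma> (Suc n)" .
  have "\<sigma> (Suc n) = 1 + x * \<sigma> n"
    unfolding \<sigma>_def sum.lessThan_Suc_shift by (simp add: sum_distrib_left)
  then have "x ^ n / \<sigma> n - x ^ Suc n / \<sigma> (Suc n) = x ^ n / (\<sigma> n * \<sigma> (Suc n))"
    using pos by (simp add: field_simps)
  also have "\<dots> \<le> 1 / (real n * real (Suc n))"
    using key pos n by (simp add: divide_simps) (simp add: algebra_simps)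
  also have "\<dots> = 1 / real n - 1 / real (Suc n)" using n by (simp add: field_simps)
  finally show "1 / real (Suc n) - x ^ Suc n / \<sigma> (Suc n) \<le> 1 / real n - x ^ n / \<sigma> n" by simp
  have "real n * x ^ n \<le> \<sigma> n"
  proof -
    have "(\<Sum>i<n. x ^ n) \<le> \<sigma> n"
      unfolding \<sigma>_def using x by (intro sum_mono power_decreasing) auto
    then show ?thesis by simp
  qed
  then show "0 \<le> 1 / real n - x ^ n / \<sigma> n"
    using pos n by (simp add: field_simps)
qed

lemma lambert_term_sums:
  fixes x :: real
  assumes x: "0 < x" "x < 1" and d: "1 \<le> d"
  shows "(\<lambda>n. if 0 < n \<and> d dvd n then x ^ n else 0) sums (x ^ d / (1 - x ^ d))"
proof -
  have "x ^ d < 1" using x d by (simp add: power_less_one_iff)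
  then have "(\<lambda>k. x ^ d * (x ^ d) ^ k) sums (x ^ d * (1 / (1 - x ^ d)))"
    using x by (intro sums_mult geometric_sums) simp
  then have *: "(\<lambda>k. x ^ (d * Suc k)) sums (x ^ d / (1 - x ^ d))"
    by (simp add: power_add power_mult)
  let ?g = "\<lambda>k. d * Suc k"
  have "strict_mono ?g" using d by (intro strict_monoI) simp
  moreover have "(if 0 < n \<and> d dvd n then x ^ n else 0) = 0" if "n \<notin> range ?g" for n
  proof -
    have "\<not> (0 < n \<and> d dvd n)"
    proof
      assume "0 < n \<and> d dvd n"
      then obtain k where "n = d * Suc k" by (metis dvdE gr0_implies_Suc mult_0_right not_gr_zero)
      then show False using that by blast
    qed
    then show ?thesis by (rule if_not_P)
  qed
  ultimately have "(\<lambda>k. if 0 < ?g k \<and> d dvd ?g k then x ^ ?g k else 0) sums (x ^ d / (1 - x ^ d))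
      \<longleftrightarrow> (\<lambda>n. if 0 < n \<and> d dvd n then x ^ n else 0) sums (x ^ d / (1 - x ^ d))"
    by (rule sums_mono_reindex)
  moreover have "(\<lambda>k. if 0 < ?g k \<and> d dvd ?g k then x ^ ?g k else 0) = (\<lambda>k. x ^ ?g k)"
    using d by (intro ext if_P) auto
  ultimately show ?thesis using * by simp
qed

lemma summable_n_times_power:
  fixes x :: real
  assumes "0 < x" "x < 1"
  shows "summable (\<lambda>n. real n * x ^ n)"
proof -
  have "summable (\<lambda>n. diffs (\<lambda>_. 1) n * x ^ n)"
    by (rule termdiff_converges[of x 1]) (use assms in \<open>auto intro: summable_geometric\<close>)
  then have "summable (\<lambda>n. x * (diffs (\<lambda>_. 1) n * x ^ n))" by (rule summable_mult)
  then have "summable (\<lambda>n. real (Suc n) * x ^ Suc n)"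
    by (simp add: diffs_def algebra_simps)
  then show ?thesis by (subst (asm) summable_Suc_iff)
qed

lemma tail_tendsto_0:
  fixes a :: "nat \<Rightarrow> real"
  assumes "summable a"
  shows "(\<lambda>D. \<Sum>n. if D < n then a n else 0) \<longlonglongrightarrow> 0"
proof -
  have "(\<Sum>n. if D < n then a n else 0) = suminf a - (\<Sum>n\<le>D. a n)" for D
  proof -
    have "(\<lambda>n. a n - (if n \<in> {..D} then a n else 0)) sums (suminf a - (\<Sum>n\<le>D. a n))"
      using assms by (intro sums_diff summable_sums sums_If_finite_set) auto
    moreover have "(\<lambda>n. a n - (if n \<in> {..D} then a n else 0)) = (\<lambda>n. if D < n then a n else 0)"
      by auto
    ultimately show ?thesis by (simp add: sums_iff)
  qed
  moreover have "(\<lambda>D. suminf a - (\<Sum>n\<le>D. a n)) \<longlonglongrightarrow> suminf a - suminf a"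
    using summable_LIMSEQ'[OF assms] by (intro tendsto_intros)
  ultimately show ?thesis by simp
qed

context real_character
begin

text \<open>Since \<open>1 - x ^ d\<close> is \<open>1 - x\<close> times a geometric sum, the
  Lambert term is \<open>(1 / d - c d) / (1 - x)\<close>. The decreasing weights contribute at most
  \<open>2 * B * c 1\<close>, and \<open>c 1 = 1 - x\<close> cancels the denominator.\<close>

lemma lambert_partial_bound:
  assumes x: "0 < x" "x < 1"
  shows "(\<Sum>d=1..D. \<chi> d * (x ^ d / (1 - x ^ d))) \<le> L_partial D / (1 - x) + 2 * B"
proof -
  define c where "c n = 1 / real n - x ^ n / (\<Sum>i<n. x ^ i)" for n
  have "\<bar>\<Sum>d=1..<Suc D. \<chi> d * c d\<bar> \<le> 2 * B * c 1"
    unfolding c_def by (rule weighted_sum_bound) (use monsky_weight_decreasing[OF x] in auto)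
  then have bound: "\<bar>\<Sum>d=1..D. \<chi> d * c d\<bar> \<le> 2 * B * (1 - x)"
    by (simp add: c_def atLeastLessThanSuc_atLeastAtMost)
  have "\<chi> d * (x ^ d / (1 - x ^ d)) = (\<chi> d / real d - \<chi> d * c d) / (1 - x)" if "d \<ge> 1" for d
  proof -
    have "(1 - x) * (\<Sum>i<d. x ^ i) = 1 - x ^ d" using one_diff_power_eq[of x d] by simp
    then have "x ^ d / (1 - x ^ d) = x ^ d / (\<Sum>i<d. x ^ i) / (1 - x)"
      by (metis divide_divide_eq_left mult.commute)
    then show ?thesis by (simp add: c_def algebra_simps)
  qed
  then have "(\<Sum>d=1..D. \<chi> d * (x ^ d / (1 - x ^ d))) = (\<Sum>d=1..D. (\<chi> d / real d - \<chi> d * c d) / (1 - x))"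
    by (intro sum.cong) auto
  also have "\<dots> = (L_partial D - (\<Sum>d=1..D. \<chi> d * c d)) / (1 - x)"
    by (simp add: L_partial_def sum_subtractf flip: sum_divide_distrib)
  also have "\<dots> \<le> (L_partial D + 2 * B * (1 - x)) / (1 - x)"
    using bound x by (intro divide_right_mono) auto
  also have "\<dots> = L_partial D / (1 - x) + 2 * B" using x by (simp add: field_simps)
  finally show ?thesis .
qed

text \<open>Truncating at \<open>D\<close> avoids interchanging two infinite series. The coefficient
  of \<open>x ^ n\<close> in the truncated Lambert series is exactly \<open>divisor_sum n\<close>
  for \<open>1 \<le> n \<le> D\<close>; beyond \<open>D\<close> it is at most \<open>D < n\<close>
  in absolute value, which the tail series absorbs.\<close>

lemma power_weighted_divisor_sum_bound:
  assumes x: "0 < x" "x < 1" and "M \<le> D"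
  shows "(\<Sum>n=1..M. divisor_sum n * x ^ n) \<le> L_partial D / (1 - x) + 2 * B + (\<Sum>n. if D < n then real n * x ^ n else 0)"
proof -
  define g where "g n = (\<Sum>d=1..D. \<chi> d * (if 0 < n \<and> d dvd n then x ^ n else 0))" for n
  define t where "t n = (if D < n then real n * x ^ n else 0)" for n
  have g: "g sums (\<Sum>d=1..D. \<chi> d * (x ^ d / (1 - x ^ d)))"
    unfolding g_def using x by (intro sums_sum sums_mult lambert_term_sums) auto
  have "summable (\<lambda>n. real n * x ^ n)"
    using x by (rule summable_n_times_power)
  then have t: "summable t"
    by (rule summable_comparison_test'[of _ 0]) (use x in \<open>auto simp: t_def\<close>)
  have low: "(if n \<in> {1..M} then divisor_sum n * x ^ n else 0) \<le> g n + t n" for n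
  proof (cases "1 \<le> n \<and> n \<le> D")
    case True
    have "g n = (\<Sum>d | d \<in> {1..D} \<and> d dvd n. \<chi> d * x ^ n)"
      unfolding g_def using True by (subst sum.inter_filter) (auto intro!: sum.cong)
    also have "{d. d \<in> {1..D} \<and> d dvd n} = {d. d dvd n}"
      using True by (auto dest: dvd_imp_le intro: Nat.gr0I)
    finally have "g n = divisor_sum n * x ^ n" by (simp add: divisor_sum_def sum_distrib_right)
    then show ?thesis using True divisor_sum_nonneg[of n] x by (simp add: t_def)
  next
    case False
    show ?thesis
    proof (cases "n = 0")
      case True
      then show ?thesis by (simp add: g_def t_def)
    next
      case n: False
      with False have "D < n" by simp
      have "\<bar>g n\<bar> \<le> (\<Sum>d=1..D. x ^ n)"
        unfolding g_def
      proof (rule order_trans[OF sum_abs], rule sum_mono)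
        fix d
        show "\<bar>\<chi> d * (if 0 < n \<and> d dvd n then x ^ n else 0)\<bar> \<le> x ^ n"
          using abs_le_1[of d] x mult_right_mono[of "\<bar>\<chi> d\<bar>" 1 "x ^ n"] by (auto simp: abs_mult)
      qed
      also have "\<dots> \<le> real n * x ^ n" using \<open>D < n\<close> x by (simp add: mult_right_mono)
      finally show ?thesis using \<open>D < n\<close> \<open>M \<le> D\<close> by (simp add: t_def)
    qed
  qed
  have "(\<lambda>n. if n \<in> {1..M} then divisor_sum n * x ^ n else 0) sums (\<Sum>n=1..M. divisor_sum n * x ^ n)"
    by (rule sums_If_finite_set) simp
  moreover have "(\<lambda>n. g n + t n) sums ((\<Sum>d=1..D. \<chi> d * (x ^ d / (1 - x ^ d))) + suminf t)"
    using g t by (intro sums_add summable_sums)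
  ultimately have "(\<Sum>n=1..M. divisor_sum n * x ^ n) \<le> (\<Sum>d=1..D. \<chi> d * (x ^ d / (1 - x ^ d))) + suminf t"
    using low by (rule_tac sums_le)
  also note lambert_partial_bound[OF x, of D]
  finally show ?thesis by (simp add: t_def)
qed

text \<open>The order of limits matters: first \<open>D\<close> tends to infinity, where
  \<open>L1 = 0\<close> removes the pole at 1 and the tail vanishes, leaving a bound free of
  \<open>x\<close>; then \<open>x\<close> tends to 1 from the left. The squares up to
  \<open>k ^ 2\<close> contradict the result.\<close>

lemma L1_nonzero: "L1 \<noteq> 0"
proof
  assume L1: "L1 = 0"
  have *: "(\<Sum>n=1..M. divisor_sum n * x ^ n) \<le> 2 * B" if x: "0 < x" "x < 1" for x M
  proof (rule LIMSEQ_le_const)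
    have "summable (\<lambda>n. real n * x ^ n)"
      using x by (rule summable_n_times_power)
    then have "(\<lambda>D. L_partial D / (1 - x) + 2 * B + (\<Sum>n. if D < n then real n * x ^ n else 0))
       \<longlonglongrightarrow> L1 / (1 - x) + 2 * B + 0"
      using x by (intro tendsto_intros L_partial_tendsto tail_tendsto_0) auto
    then show "(\<lambda>D. L_partial D / (1 - x) + 2 * B + (\<Sum>n. if D < n then real n * x ^ n else 0))
       \<longlonglongrightarrow> 2 * B" by (simp add: L1)
    show "\<exists>N. \<forall>D\<ge>N. (\<Sum>n=1..M. divisor_sum n * x ^ n)
        \<le> L_partial D / (1 - x) + 2 * B + (\<Sum>n. if D < n then real n * x ^ n else 0)"
      using power_weighted_divisor_sum_bound[OF x] by blast
  qed
  have "(\<Sum>n=1..M. divisor_sum n) \<le> 2 * B" for M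
  proof (rule tendsto_upperbound)
    have "((\<lambda>x. \<Sum>n=1..M. divisor_sum n * x ^ n) \<longlongrightarrow> (\<Sum>n=1..M. divisor_sum n * 1 ^ n)) (at_left 1)"
      by (intro tendsto_intros)
    then show "((\<lambda>x. \<Sum>n=1..M. divisor_sum n * x ^ n) \<longlongrightarrow> (\<Sum>n=1..M. divisor_sum n)) (at_left 1)" by simp
    show "\<forall>\<^sub>F x in at_left 1. (\<Sum>n=1..M. divisor_sum n * x ^ n) \<le> 2 * B"
      by (rule eventually_mono[OF eventually_at_left_real[of 0 1]]) (use * in auto)
  qed simp
  moreover obtain k where "2 * B < real k" using reals_Archimedean2 by blast
  ultimately show False using sum_divisor_sum_lower[of k] by (meson not_le order_trans)
qed

end

text \<open>The threshold 3 is the first integer past e, where \<open>ln x / x\<close> starts to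
  decrease; hence \<open>m = 2\<close> is split off when summation by parts is applied to these
  weights.\<close>

lemma ln_div_self_decreasing:
  fixes x y :: real
  assumes "3 \<le> x" "x \<le> y"
  shows "ln y / y \<le> ln x / x"
proof -
  have e: "exp 1 \<le> x" using exp_le assms by linarith
  then have "1 \<le> ln x" using assms by (simp add: ln_ge_iff)
  have "ln y - ln x = ln (y / x)" using assms by (simp add: ln_div)
  also have "\<dots> \<le> y / x - 1" using assms by (intro ln_le_minus_one) simp
  also have "\<dots> \<le> (y / x - 1) * ln x"
    using mult_left_mono[OF \<open>1 \<le> ln x\<close>, of "y / x - 1"] assms by simp
  finally have "ln y \<le> y / x * ln x" by (simp add: algebra_simps)
  then show ?thesis using assms by (simp add: field_simps)
qed

context real_character
begin

lemma sum_chi_ln_bounded: "\<exists>C. \<forall>n. \<bar>\<Sum>m=1..n. \<chi> m / real m * ln (real m)\<bar> \<le> C"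
proof (intro exI allI)
  fix n
  let ?g = "\<lambda>m. ln (real m) / real m"
  define C where "C = ?g 2 + 2 * B * ?g 3"
  have g3: "\<bar>\<Sum>m=3..<Suc n. \<chi> m * ?g m\<bar> \<le> 2 * B * ?g 3"
    by (rule weighted_sum_bound) (auto intro: ln_div_self_decreasing)
  have e: "(\<Sum>m=1..n. \<chi> m / real m * ln (real m)) = (\<Sum>m=1..<Suc n. \<chi> m * ?g m)"
    by (simp add: atLeastLessThanSuc_atLeastAtMost)
  have C: "0 \<le> C" "\<bar>\<chi> 2 * ?g 2\<bar> + 2 * B * ?g 3 \<le> C"
    unfolding C_def using B_nonneg abs_le_1[of 2] mult_right_mono[OF abs_le_1, of "?g 2" 2]
    by (auto simp: abs_mult)
  consider "n \<le> 1" | "n \<ge> 2" by linarith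
  then show "\<bar>\<Sum>m=1..n. \<chi> m / real m * ln (real m)\<bar> \<le> C"
  proof cases
    case 1
    then have "n = 0 \<or> n = 1" by linarith
    then show ?thesis using C by auto
  next
    case 2
    then have "(\<Sum>m=1..<Suc n. \<chi> m * ?g m) = \<chi> 2 * ?g 2 + (\<Sum>m=3..<Suc n. \<chi> m * ?g m)"
    proof -
      have "{1..<Suc n} = {1, 2} \<union> {3..<Suc n}" using 2 by auto
      then show ?thesis by (simp add: sum.union_disjoint)
    qed
    then show ?thesis unfolding e using g3 C by linarith
  qed
qed

text \<open>Mertens' method: the bounded sum of \<open>\<chi> m * ln m / m\<close> equals the sum of
  \<open>\<chi> d * mangoldt d / d * L_partial (n div d)\<close>. Replacing each
  \<open>L_partial\<close> by \<open>L1\<close> costs at most \<open>2 * B / n\<close> times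
  Chebyshev's sum, so at most \<open>8 * B\<close>, and one may divide by \<open>L1\<close>.\<close>

theorem sum_chi_mangoldt_bounded: "\<exists>C. \<forall>n. \<bar>\<Sum>m=1..n. \<chi> m * mangoldt m / real m\<bar> \<le> C"
proof -
  obtain C where C: "\<And>n. \<bar>\<Sum>m=1..n. \<chi> m / real m * ln (real m)\<bar> \<le> C"
    using sum_chi_ln_bounded by blast
  have "\<bar>\<Sum>m=1..n. \<chi> m * mangoldt m / real m\<bar> \<le> (C + 8 * B) / \<bar>L1\<bar>" for n
  proof (cases "n = 0")
    case True
    then show ?thesis using C[of 0] B_nonneg by simp
  next
    case False
    define D where "D = (\<Sum>m=1..n. \<chi> m * mangoldt m / real m)"
    define E where "E = (\<Sum>d=1..n. \<chi> d * mangoldt d / real d * (L1 - L_partial (n div d)))"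
    have "(\<Sum>m=1..n. \<chi> m / real m * ln (real m)) =
        (\<Sum>d=1..n. mangoldt d * (\<Sum>k=1..n div d. \<chi> (d * k) / real (d * k)))"
      by (rule sum_ln_eq_sum_mangoldt)
    also have "\<dots> = (\<Sum>d=1..n. \<chi> d * mangoldt d / real d * L_partial (n div d))"
      unfolding L_partial_def by (intro sum.cong refl) (simp add: mult sum_distrib_left mult_ac)
    also have "\<dots> = L1 * D - E"
      unfolding D_def E_def right_diff_distrib sum_subtractf
      by (simp add: sum_distrib_left algebra_simps)
    finally have LD: "\<bar>L1 * D\<bar> \<le> C + \<bar>E\<bar>" using C[of n] by linarith
    have "\<bar>E\<bar> \<le> (\<Sum>d=1..n. 2 * B * mangoldt d / real n)"
      unfolding E_def
    proof (rule order_trans[OF sum_abs], rule sum_mono)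
      fix d assume d: "d \<in> {1..n}"
      have "real n \<le> real d * real (n div d + 1)"
      proof -
        have "n < d * (n div d + 1)" using d dividend_less_times_div[of d n] by simp
        then show ?thesis by (metis less_imp_le of_nat_le_iff of_nat_mult)
      qed
      then have "2 * B / real (n div d + 1) \<le> 2 * B * real d / real n"
        using False d B_nonneg mult_left_mono[of "real n" "real d * real (n div d + 1)" "2 * B"]
        by (simp add: divide_simps mult_ac)
      then have l: "\<bar>L1 - L_partial (n div d)\<bar> \<le> 2 * B * real d / real n"
        using L1_diff[of "n div d"] by linarith
      have "\<bar>\<chi> d * mangoldt d / real d * (L1 - L_partial (n div d))\<bar>
          = \<bar>\<chi> d\<bar> * (mangoldt d / real d * \<bar>L1 - L_partial (n div d)\<bar>)"
        by (simp add: abs_mult)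
      also have "\<dots> \<le> 1 * (mangoldt d / real d * (2 * B * real d / real n))"
        using l by (intro mult_mono mult_left_mono mult_nonneg_nonneg divide_nonneg_nonneg)
          (auto simp: abs_le_1 mangoldt_nonneg)
      also have "\<dots> = 2 * B * mangoldt d / real n" using d by simp
      finally show "\<bar>\<chi> d * mangoldt d / real d * (L1 - L_partial (n div d))\<bar> \<le> 2 * B * mangoldt d / real n" .
    qed
    also have "\<dots> = 2 * B / real n * (\<Sum>d=1..n. mangoldt d)"
      by (simp add: sum_distrib_left)
    also have "\<dots> \<le> 2 * B / real n * (4 * real n)"
      using B_nonneg by (intro mult_left_mono chebyshev_psi_upper) auto
    also have "\<dots> = 8 * B" using False by simp
    finally have "\<bar>L1\<bar> * \<bar>D\<bar> \<le> C + 8 * B" using LD by (simp add: abs_mult)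
    then show ?thesis using L1_nonzero by (simp add: D_def field_simps)
  qed
  then show ?thesis by blast
qed

end

text \<open>From \<open>ln p \<le> 2 * sqrt p\<close> the sum is at most 4 divided by the cube of
  \<open>sqrt p\<close>. The difference on the right dominates this and is chosen because it
  telescopes over \<open>p\<close>.\<close>

lemma sum_prime_powers_le:
  assumes "prime p"
  shows "(\<Sum>k=2..n. mangoldt (p ^ k) / real (p ^ k)) \<le> 8 * (1 / sqrt (real (p - 1)) - 1 / sqrt (real p))"
proof (cases "2 \<le> n")
  case False
  then show ?thesis using prime_gt_1_nat[OF assms] by (simp add: frac_le)
next
  case True
  define x where "x = 1 / real p"
  define r q where "r = sqrt (real p)" and "q = sqrt (real (p - 1))"
  have p: "2 \<le> p" using assms by (rule prime_ge_2_nat)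
  then have x: "0 < x" "x \<le> 1 / 2" by (auto simp: x_def field_simps)
  have rq: "0 < q" "q \<le> r" "r ^ 2 = real p" "q ^ 2 = real p - 1"
    using p by (auto simp: r_def q_def of_nat_diff)
  have "(1 - x) * (\<Sum>k=2..n. x ^ k) = x ^ 2 - x ^ Suc n" by (rule sum_gp_multiplied[OF True])
  also have "\<dots> \<le> x ^ 2" using x by simp
  also have "\<dots> \<le> (1 - x) * (2 * x ^ 2)" using mult_right_mono[of 1 "2 * (1 - x)" "x ^ 2"] x by simp
  finally have geo: "(\<Sum>k=2..n. x ^ k) \<le> 2 * x ^ 2" using x by (subst (asm) mult_le_cancel_left_pos) auto
  have ln: "ln (real p) \<le> 2 * r"
  proof -
    have "ln (real p) = 2 * ln r" unfolding r_def using p by (simp add: ln_sqrt)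
    moreover have "ln r \<le> r - 1" using rq by (intro ln_le_minus_one) auto
    ultimately show ?thesis by simp
  qed
  have "(\<Sum>k=2..n. mangoldt (p ^ k) / real (p ^ k)) = (\<Sum>k=2..n. ln (real p) * x ^ k)"
    using assms by (intro sum.cong refl) (simp add: x_def power_divide)
  also have "\<dots> = ln (real p) * (\<Sum>k=2..n. x ^ k)" by (simp add: sum_distrib_left)
  also have "\<dots> \<le> (2 * r) * (2 * x ^ 2)"
    using ln geo x p rq by (intro mult_mono sum_nonneg) auto
  also have "\<dots> = 4 / r ^ 3"
    using rq p by (simp add: x_def power2_eq_square power3_eq_cube flip: rq(3)) 
  also have "\<dots> = 8 * (1 / (r * r * (r + r)))" by (simp add: power3_eq_cube)
  also have "\<dots> \<le> 8 * (1 / (q * r * (r + q)))"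
    using rq by (intro mult_left_mono divide_left_mono mult_mono) auto
  also have "1 / (q * r * (r + q)) = (r ^ 2 - q ^ 2) / (q * r * (r + q))" using rq by simp
  also have "\<dots> = 1 / q - 1 / r"
    using rq by (simp add: divide_simps) (simp add: algebra_simps power2_eq_square)
  finally show ?thesis by (simp add: r_def q_def)
qed

lemma sum_proper_prime_powers_bounded:
  "(\<Sum>m | m \<in> {1..n} \<and> \<not> prime m. mangoldt m / real m) \<le> 8"
proof -
  let ?g = "\<lambda>p. 1 / sqrt (real p)"
  let ?A = "{p \<in> {1..n}. prime p} \<times> {2..n}"
  have sub: "m \<in> (\<lambda>(p, k). p ^ k) ` ?A" if m: "m \<in> {1..n}" "\<not> prime m" "primepow m" for m
  proof -
    obtain p k where pk: "prime p" "k > 0" "m = p ^ k" using m by (auto simp: primepow_def)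
    have "k \<noteq> 1" using pk m by auto
    moreover have "k < p ^ k" using pk prime_gt_1_nat[of p] by (intro power_gt_expt) auto
    moreover have "p \<le> p ^ k" using pk by (intro self_le_power) (auto dest: prime_gt_0_nat)
    ultimately have "(p, k) \<in> ?A" using m pk prime_gt_0_nat[of p] by auto
    then show ?thesis using pk by force
  qed
  have "(\<Sum>m | m \<in> {1..n} \<and> \<not> prime m. mangoldt m / real m)
      = (\<Sum>m | m \<in> {1..n} \<and> \<not> prime m \<and> primepow m. mangoldt m / real m)"
    by (intro sum.mono_neutral_right) (auto simp: mangoldt_def)
  also have "\<dots> \<le> (\<Sum>m\<in>(\<lambda>(p, k). p ^ k) ` ?A. mangoldt m / real m)"
    by (rule sum_mono2) (use sub in \<open>auto simp: mangoldt_nonneg\<close>)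
  \<comment> \<open>The terms are nonnegative, so injectivity of \<open>(p, k)\<close> to
    \<open>p ^ k\<close> need not be proved.\<close>
  also have "\<dots> \<le> (\<Sum>(p, k)\<in>?A. mangoldt (p ^ k) / real (p ^ k))"
    by (rule order_trans[OF sum_image_le]) (auto simp: mangoldt_nonneg case_prod_unfold)
  also have "\<dots> = (\<Sum>p\<in>{p \<in> {1..n}. prime p}. \<Sum>k=2..n. mangoldt (p ^ k) / real (p ^ k))"
    by (rule sum.cartesian_product[symmetric])
  also have "\<dots> \<le> (\<Sum>p\<in>{p \<in> {1..n}. prime p}. 8 * (?g (p - 1) - ?g p))"
    by (intro sum_mono sum_prime_powers_le) auto
  also have "\<dots> \<le> (\<Sum>p=2..n. 8 * (?g (p - 1) - ?g p))"
    by (rule sum_mono2) (auto dest: prime_ge_2_nat simp: frac_le)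
  also have "\<dots> \<le> 8"
  proof (cases "2 \<le> n")
    case True
    then have "(\<Sum>p=2..n. 8 * (?g (p - 1) - ?g p)) = 8 * (?g 1 - ?g n)"
      by (induction n rule: dec_induct) (simp_all add: algebra_simps)
    then show ?thesis by simp
  qed simp
  finally show ?thesis .
qed

section \<open>Primes with prescribed Legendre symbols\<close>

text \<open>
  The weight \<open>\<Prod>i\<in>I. 1 + \<epsilon> i * \<chi> i m\<close> vanishes at every prime with a wrong sign. Expanding
  it over the subsets of \<open>I\<close>, only the empty subset makes the weighted sum of \<open>\<Lambda> m / m\<close> diverge.
\<close>

theorem prime_with_prescribed_characters:
  fixes \<chi> :: "'i \<Rightarrow> nat \<Rightarrow> real" and \<epsilon> :: "'i \<Rightarrow> real"
  assumes I: "finite I" and T: "finite T"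
    and eps: "\<And>i. i \<in> I \<Longrightarrow> \<epsilon> i \<in> {-1, 1}"
    and char: "\<And>J. J \<subseteq> I \<Longrightarrow> J \<noteq> {} \<Longrightarrow> \<exists>B. real_character (\<lambda>n. \<Prod>i\<in>J. \<chi> i n) B"
    and nz: "\<And>p i. prime p \<Longrightarrow> p \<notin> T \<Longrightarrow> i \<in> I \<Longrightarrow> \<chi> i p \<noteq> 0"
  shows "\<exists>p. prime p \<and> p \<notin> T \<and> (\<forall>i\<in>I. \<chi> i p = \<epsilon> i)"
proof (rule ccontr)
  assume contra: "\<nexists>p. prime p \<and> p \<notin> T \<and> (\<forall>i\<in>I. \<chi> i p = \<epsilon> i)"
  have vals: "\<chi> i n \<in> {-1, 0, 1}" if i: "i \<in> I" for i n
  proof -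
    obtain B where "real_character (\<lambda>n. \<Prod>i\<in>{i}. \<chi> i n) B" using char[of "{i}"] i by auto
    from real_character.vals[OF this, of n] show ?thesis by simp
  qed
  define w where "w m = (\<Prod>i\<in>I. 1 + \<epsilon> i * \<chi> i m)" for m
  define R where "R = (2::real) ^ card I"
  have fac: "0 \<le> 1 + \<epsilon> i * \<chi> i m" "1 + \<epsilon> i * \<chi> i m \<le> 2" if "i \<in> I" for i m
    using eps[OF that] vals[OF that, of m] by auto
  have w: "0 \<le> w m" "w m \<le> R" for m
  proof -
    show "0 \<le> w m" unfolding w_def by (intro prod_nonneg fac)
    have "w m \<le> (\<Prod>i\<in>I. 2)" unfolding w_def by (intro prod_mono) (use fac in auto)
    then show "w m \<le> R" by (simp add: R_def)
  qed
  have w0: "w p = 0" if p: "prime p" "p \<notin> T" for p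
  proof -
    obtain i where i: "i \<in> I" "\<chi> i p \<noteq> \<epsilon> i" using contra p by blast
    then have "1 + \<epsilon> i * \<chi> i p = 0"
      using eps[OF i(1)] vals[OF i(1), of p] nz[OF p i(1)] by auto
    then show ?thesis unfolding w_def using i I by (intro prod_zero) auto
  qed
  \<comment> \<open>If no suitable prime exists, only the primes in \<open>T\<close> and the proper
    prime powers carry weight, so the sum is bounded independently of \<open>n\<close>, against
    \<open>mertens_lower\<close>.\<close>
  have "(\<Sum>m=1..n. mangoldt m / real m * w m) \<le> R * ((\<Sum>p\<in>T. mangoldt p / real p) + 8)" for n
  proof -
    have "(\<Sum>m=1..n. mangoldt m / real m * w m)
        = (\<Sum>m\<in>{m\<in>{1..n}. prime m}. mangoldt m / real m * w m)
        + (\<Sum>m\<in>{m\<in>{1..n}. \<not> prime m}. mangoldt m / real m * w m)"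
      by (subst sum.union_disjoint[symmetric]) (auto intro!: sum.cong)
    also have "(\<Sum>m\<in>{m\<in>{1..n}. prime m}. mangoldt m / real m * w m)
        = (\<Sum>m\<in>{m\<in>{1..n}. prime m \<and> m \<in> T}. mangoldt m / real m * w m)"
      by (intro sum.mono_neutral_right) (auto simp: w0)
    also have "\<dots> \<le> (\<Sum>m\<in>{m\<in>{1..n}. prime m \<and> m \<in> T}. mangoldt m / real m * R)"
      by (intro sum_mono mult_left_mono w) (auto simp: mangoldt_nonneg)
    also have "\<dots> \<le> (\<Sum>p\<in>T. mangoldt p / real p * R)"
      using T by (intro sum_mono2) (auto simp: mangoldt_nonneg R_def)
    also have "(\<Sum>m\<in>{m\<in>{1..n}. \<not> prime m}. mangoldt m / real m * w m)
        \<le> (\<Sum>m\<in>{m\<in>{1..n}. \<not> prime m}. mangoldt m / real m * R)"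
      by (intro sum_mono mult_left_mono w) (auto simp: mangoldt_nonneg)
    also have "\<dots> \<le> 8 * R"
      using mult_right_mono[OF sum_proper_prime_powers_bounded, of R n]
      by (simp add: sum_distrib_right R_def)
    finally show ?thesis by (simp add: distrib_left sum_distrib_left mult_ac)
  qed
  moreover have "\<exists>C. \<forall>n. \<bar>(\<Prod>i\<in>J. \<epsilon> i) * (\<Sum>m=1..n. (\<Prod>i\<in>J. \<chi> i m) * mangoldt m / real m)\<bar> \<le> C"
    if J: "J \<in> Pow I - {{}}" for J
  proof -
    obtain B where "real_character (\<lambda>n. \<Prod>i\<in>J. \<chi> i n) B" using char[of J] J by auto
    from real_character.sum_chi_mangoldt_bounded[OF this]
    obtain C where C: "\<And>n. \<bar>\<Sum>m=1..n. (\<Prod>i\<in>J. \<chi> i m) * mangoldt m / real m\<bar> \<le> C" by blast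
    have "\<bar>\<Prod>i\<in>J. \<epsilon> i\<bar> = 1"
      unfolding abs_prod using J eps by (intro prod.neutral) fastforce
    then show ?thesis using C by (auto simp: abs_mult)
  qed
  then obtain C where C: "\<And>J n. J \<in> Pow I - {{}} \<Longrightarrow>
      \<bar>(\<Prod>i\<in>J. \<epsilon> i) * (\<Sum>m=1..n. (\<Prod>i\<in>J. \<chi> i m) * mangoldt m / real m)\<bar> \<le> C J"
    by metis
  have "ln (real n) - 1 - (\<Sum>J\<in>Pow I - {{}}. C J) \<le> (\<Sum>m=1..n. mangoldt m / real m * w m)"
    if "n \<ge> 1" for n
  proof -
    have "w m = (\<Sum>J\<in>Pow I. (\<Prod>i\<in>J. \<epsilon> i) * (\<Prod>i\<in>J. \<chi> i m))" for m
      unfolding w_def by (subst add.commute, subst prod_add[OF I]) (simp add: prod.distrib)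
    then have "(\<Sum>m=1..n. mangoldt m / real m * w m)
        = (\<Sum>m=1..n. \<Sum>J\<in>Pow I. (\<Prod>i\<in>J. \<epsilon> i) * ((\<Prod>i\<in>J. \<chi> i m) * mangoldt m / real m))"
      by (simp add: sum_distrib_left sum_divide_distrib mult_ac)
    also have "\<dots> = (\<Sum>J\<in>Pow I. (\<Prod>i\<in>J. \<epsilon> i) * (\<Sum>m=1..n. (\<Prod>i\<in>J. \<chi> i m) * mangoldt m / real m))"
      by (subst sum.swap) (simp add: sum_distrib_left)
    also have "\<dots> = (\<Sum>m=1..n. mangoldt m / real m) +
        (\<Sum>J\<in>Pow I - {{}}. (\<Prod>i\<in>J. \<epsilon> i) * (\<Sum>m=1..n. (\<Prod>i\<in>J. \<chi> i m) * mangoldt m / real m))"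
      using I by (subst sum.remove[of _ "{}"]) auto
    also have "\<dots> \<ge> (ln (real n) - 1) + (\<Sum>J\<in>Pow I - {{}}. - C J)"
    proof (intro add_mono mertens_lower that sum_mono)
      fix J assume "J \<in> Pow I - {{}}"
      from C[OF this, of n]
      show "- C J \<le> (\<Prod>i\<in>J. \<epsilon> i) * (\<Sum>m=1..n. (\<Prod>i\<in>J. \<chi> i m) * mangoldt m / real m)"
        by linarith
    qed
    finally show ?thesis by (simp add: sum_negf)
  qed
  ultimately have bd: "ln (real n) \<le> 1 + (\<Sum>J\<in>Pow I - {{}}. C J) + R * ((\<Sum>p\<in>T. mangoldt p / real p) + 8)"
    (is "_ \<le> ?K") if "n \<ge> 1" for n
    using that by (smt (verit))
  obtain n where n: "exp ?K < real n" using reals_Archimedean2 by blast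
  then have "0 < real n" using exp_gt_zero[of ?K] by linarith
  then have "?K < ln (real n)" using n by (metis exp_less_cancel_iff exp_ln)
  then show False using bd[of n] \<open>0 < real n\<close> by auto
qed

section \<open>From quadratic residues to sums of three squares\<close>

text \<open>Thue's argument: the box has more points than there are residues modulo
  \<open>M\<close>, so two points collide under the linear form, and their difference is a short
  vector.\<close>

lemma finite_pigeonhole_lattice:
  fixes \<alpha> \<beta> M :: int and A B C :: nat
  assumes "0 < M" and big: "M < int ((A + 1) * (B + 1) * (C + 1))"
  obtains x t w where "(x, t, w) \<noteq> (0, 0, 0)" "M dvd x - \<alpha> * t - \<beta> * w"
    "\<bar>x\<bar> \<le> int A" "\<bar>t\<bar> \<le> int B" "\<bar>w\<bar> \<le> int C"
proof -
  define X where "X = {0..int A} \<times> {0..int B} \<times> {0..int C}"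
  define g where "g = (\<lambda>(x, t, w). (x - \<alpha> * t - \<beta> * w) mod M)"
  have "g ` X \<subseteq> {0..<M}" using \<open>0 < M\<close> by (auto simp: g_def)
  then have "card (g ` X) \<le> nat M" using card_mono[of "{0..<M}" "g ` X"] by simp
  also have "\<dots> < card X"
  proof -
    have "card X = (A + 1) * (B + 1) * (C + 1)"
      by (simp add: X_def card_cartesian_product nat_add_distrib algebra_simps)
    then show ?thesis using big \<open>0 < M\<close> by (metis nat_less_iff less_imp_le)
  qed
  finally have "\<not> inj_on g X" using card_image by fastforce
  then obtain u v where uv: "u \<in> X" "v \<in> X" "u \<noteq> v" "g u = g v" unfolding inj_on_def by blast
  obtain x1 t1 w1 x2 t2 w2 where e: "u = (x1, t1, w1)" "v = (x2, t2, w2)" by (metis prod_cases3)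
  have "M dvd (x1 - \<alpha> * t1 - \<beta> * w1) - (x2 - \<alpha> * t2 - \<beta> * w2)"
    using uv(4) by (simp add: e g_def mod_eq_dvd_iff)
  then have "M dvd (x1 - x2) - \<alpha> * (t1 - t2) - \<beta> * (w1 - w2)" by (simp add: algebra_simps)
  then show ?thesis
    using uv by (intro that[of "x1 - x2" "t1 - t2" "w1 - w2"]) (auto simp: e X_def)
qed

lemma crt_int:
  fixes a b m n :: int
  assumes "coprime m n"
  obtains x where "m dvd x - a" "n dvd x - b"
  using binary_chinese_remainder_int[OF assms, of a b] by (auto simp: cong_iff_dvd_diff)

lemma sqrt_less_Suc_floor: "sqrt (real_of_int m) < real (nat \<lfloor>sqrt (real_of_int m)\<rfloor> + 1)"
  by linarith

lemma power2_le_of_abs_le_floor_sqrt: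
  fixes y m :: int
  assumes "\<bar>y\<bar> \<le> int (nat \<lfloor>sqrt (real_of_int m)\<rfloor>)" "0 \<le> m"
  shows "y ^ 2 \<le> m"
proof -
  have "\<bar>real_of_int y\<bar> \<le> sqrt m" using assms by (auto simp: le_floor_iff)
  then have "(real_of_int y) ^ 2 \<le> m" using assms(2) by (metis of_int_0_le_iff real_sqrt_abs real_sqrt_le_iff)
  then show ?thesis by (metis of_int_le_iff of_int_power)
qed

lemma ternary_form_represents:
  fixes n Q r s :: int
  assumes pos: "0 < n" "0 < Q" and cop: "coprime n Q"
    and s: "Q dvd s ^ 2 - n" and r: "n dvd r ^ 2 + Q"
    and nonsquare: "\<And>k. k ^ 2 \<noteq> Q"
  obtains W X T where "0 < W" "n * W ^ 2 = X ^ 2 + Q * T ^ 2"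
proof -
  \<comment> \<open>With these coefficients a lattice point satisfies \<open>x = r * t\<close>
    modulo \<open>n\<close> and \<open>x = s * w\<close> modulo \<open>Q\<close>. The first makes
    \<open>x ^ 2 + Q * t ^ 2\<close>, the second \<open>x ^ 2 - n * w ^ 2\<close>, vanish there, so
    \<open>n * Q\<close> divides \<open>v\<close> below.\<close>
  obtain \<alpha> where \<alpha>: "n dvd \<alpha> - r" "Q dvd \<alpha> - 0" using crt_int[OF cop] .
  obtain \<beta> where \<beta>: "n dvd \<beta> - 0" "Q dvd \<beta> - s" using crt_int[OF cop] .
  \<comment> \<open>The sides balance the three terms of the form, each at most
    \<open>n * Q\<close>, while their product is just the index.\<close>
  define A B C where "A = nat \<lfloor>sqrt (n * Q)\<rfloor>" and "B = nat \<lfloor>sqrt n\<rfloor>" and "C = nat \<lfloor>sqrt Q\<rfloor>"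
  have "real_of_int (n * Q) < real ((A + 1) * (B + 1) * (C + 1))"
  proof -
    have "sqrt (n * Q) < real (A + 1)" "sqrt n < real (B + 1)" "sqrt Q < real (C + 1)"
      unfolding A_def B_def C_def by (rule sqrt_less_Suc_floor)+
    then have "sqrt (n * Q) * sqrt n * sqrt Q < real (A + 1) * real (B + 1) * real (C + 1)"
      using pos by (intro mult_strict_mono) auto
    moreover have "sqrt (n * Q) * sqrt n * sqrt Q = n * Q"
      using pos by (simp add: real_sqrt_mult mult.assoc) (simp add: algebra_simps)
    ultimately show ?thesis by (simp only: of_nat_mult)
  qed
  then have big: "n * Q < int ((A + 1) * (B + 1) * (C + 1))" by linarith
  obtain x t w where nz: "(x, t, w) \<noteq> (0, 0, 0)" and d: "n * Q dvd x - \<alpha> * t - \<beta> * w"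
    and bd: "\<bar>x\<bar> \<le> int A" "\<bar>t\<bar> \<le> int B" "\<bar>w\<bar> \<le> int C"
    using finite_pigeonhole_lattice[OF _ big] pos by (metis mult_pos_pos)
  have bd2: "x ^ 2 \<le> n * Q" "t ^ 2 \<le> n" "w ^ 2 \<le> Q"
    using bd pos by (auto intro!: power2_le_of_abs_le_floor_sqrt simp: A_def B_def C_def)
  define v where "v = x ^ 2 + Q * t ^ 2 - n * w ^ 2"
  have "n dvd v"
  proof -
    have "n dvd x - \<alpha> * t - \<beta> * w" using d dvd_mult_left by blast
    then have "n dvd (x - \<alpha> * t - \<beta> * w) + (\<alpha> - r) * t + \<beta> * w"
      using \<alpha> \<beta> by (intro dvd_add dvd_mult2) auto
    then have "n dvd x - r * t" by (simp add: algebra_simps)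
    then have "n dvd (x - r * t) * (x + r * t) + (r ^ 2 + Q) * t ^ 2 - n * w ^ 2" using r by simp
    then show ?thesis by (simp add: v_def algebra_simps power2_eq_square)
  qed
  moreover have "Q dvd v"
  proof -
    have "Q dvd x - \<alpha> * t - \<beta> * w" using d dvd_mult_right by blast
    then have "Q dvd (x - \<alpha> * t - \<beta> * w) + \<alpha> * t + (\<beta> - s) * w"
      using \<alpha> \<beta> by (intro dvd_add dvd_mult2) auto
    then have "Q dvd x - s * w" by (simp add: algebra_simps)
    then have "Q dvd (x - s * w) * (x + s * w) + (s ^ 2 - n) * w ^ 2 + Q * t ^ 2" using s by simp
    then show ?thesis by (simp add: v_def algebra_simps power2_eq_square)
  qed
  ultimately have "n * Q dvd v" using cop by (rule divides_mult)
  then obtain k where k: "v = n * Q * k" by (elim dvdE)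
  have nQ: "0 < n * Q" using pos by simp
  have Qt: "0 \<le> Q * t ^ 2" "Q * t ^ 2 \<le> n * Q" using bd2 pos by (auto simp: mult.commute)
  have nw: "0 \<le> n * w ^ 2" "n * w ^ 2 \<le> n * Q" using bd2 pos by auto
  \<comment> \<open>The box alone gives \<open>v\<close> between \<open>- n * Q\<close> and
    \<open>2 * n * Q\<close>. Both extremes would make \<open>Q\<close> a square, so only the
    multiples 0 and \<open>n * Q\<close> remain.\<close>
  have "w ^ 2 \<noteq> Q" by (rule nonsquare)
  then have "n * w ^ 2 < n * Q" using bd2 pos by simp
  then have "- (n * Q) < v" unfolding v_def using Qt by (smt (verit) zero_le_power2)
  then have "-1 < k" unfolding k using nQ by (metis mult_minus1_right mult_less_cancel_left_pos)
  moreover have "k < 2"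
  proof (rule ccontr)
    assume "\<not> k < 2"
    then have "n * Q * 2 \<le> v" unfolding k using nQ by (intro mult_left_mono) auto
    then have e: "x ^ 2 = n * Q" "Q * t ^ 2 = n * Q" unfolding v_def using bd2 Qt nw by linarith+
    then have "t ^ 2 = n" using pos by simp
    with e have "x ^ 2 = t ^ 2 * Q" "t \<noteq> 0" using pos by auto
    then have "t dvd x" by (metis dvd_triv_left pow_divides_pow_iff zero_less_numeral)
    then obtain j where "x = t * j" by (elim dvdE)
    then have "j ^ 2 = Q" using \<open>x ^ 2 = t ^ 2 * Q\<close> \<open>t \<noteq> 0\<close> by (simp add: power_mult_distrib)
    then show False using nonsquare by blast
  qed
  \<comment> \<open>If \<open>v = n * Q\<close>, multiply \<open>x\<^sup>2 + Q * t\<^sup>2 = n * (w\<^sup>2 + Q)\<close> by the norm \<open>w\<^sup>2 + Q\<close>.\<close>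
  ultimately consider "v = 0" | "v = n * Q" using k by (cases "k = 0") auto
  then show ?thesis
  proof cases
    case 1
    then have e: "n * w ^ 2 = x ^ 2 + Q * t ^ 2" by (simp add: v_def)
    have "w \<noteq> 0"
    proof
      assume "w = 0"
      then have "x ^ 2 + Q * t ^ 2 = 0" using e by simp
      then have "x ^ 2 = 0" "Q * t ^ 2 = 0" using Qt by (smt (verit) zero_le_power2)+
      then show False using nz pos \<open>w = 0\<close> by simp
    qed
    then show ?thesis using e by (intro that[of "\<bar>w\<bar>" x t]) auto
  next
    case 2
    then have e: "x ^ 2 + Q * t ^ 2 = n * (w ^ 2 + Q)" by (simp add: v_def algebra_simps)
    have "n * (w ^ 2 + Q) ^ 2 = (x ^ 2 + Q * t ^ 2) * (w ^ 2 + Q)"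
      unfolding e by (simp add: power2_eq_square)
    also have "\<dots> = (x * w + Q * t) ^ 2 + Q * (x - t * w) ^ 2"
      by (simp add: power2_eq_square algebra_simps)
    finally show ?thesis using pos by (intro that[of "w ^ 2 + Q"]) (auto intro: add_nonneg_pos)
  qed
qed

text \<open>
  Join the rational point \<open>(x, y, z) / w\<close> of the sphere to a nearest integer point \<open>(X, Y, Z)\<close>;
  the line meets the sphere again in a rational point with the smaller denominator \<open>w'\<close>.
\<close>

lemma davenport_cassels:
  fixes n w x y z :: int
  assumes "0 < w" "n * w ^ 2 = x ^ 2 + y ^ 2 + z ^ 2"
  shows "\<exists>x y z. n = x ^ 2 + y ^ 2 + z ^ 2"
  using assms
proof (induction "nat w" arbitrary: w x y z rule: less_induct)
  case less
  have "\<exists>X. 2 * \<bar>a - w * X\<bar> \<le> w" for a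
  proof -
    have "0 \<le> (2 * a + w) mod (2 * w)" "(2 * a + w) mod (2 * w) < 2 * w"
      using less.prems(1) by simp_all
    then have "w * ((2 * a + w) div (2 * w)) * 2 \<le> 2 * a + w"
      "2 * a + w < w * ((2 * a + w) div (2 * w)) * 2 + 2 * w"
      using mult_div_mod_eq[of "2 * w" "2 * a + w"] by (simp_all only: mult_ac)
    then show ?thesis by (intro exI[of _ "(2 * a + w) div (2 * w)"]) (cases "0 \<le> a - w * ((2 * a + w) div (2 * w))", simp_all)
  qed
  then obtain X Y Z where XYZ: "2 * \<bar>x - w * X\<bar> \<le> w" "2 * \<bar>y - w * Y\<bar> \<le> w" "2 * \<bar>z - w * Z\<bar> \<le> w"
    by metis
  have sq: "4 * u ^ 2 \<le> w ^ 2" if "2 * \<bar>u\<bar> \<le> w" for u :: int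
    using power_mono[OF that, of 2] by (simp add: power_mult_distrib)
  \<comment> \<open>The second intersection has coordinates \<open>(a * x + b * X) / w'\<close> and
    so on. Here \<open>w * w' = D\<close> is \<open>w ^ 2\<close> times the squared distance to the
    integer point; each coordinate is off by at most 1/2, so this is at most
    \<open>3 / 4 * w ^ 2\<close> and \<open>w' < w\<close>. If \<open>D = 0\<close> the point is
    already integral.\<close>
  define a where "a = X ^ 2 + Y ^ 2 + Z ^ 2 - n"
  define b where "b = 2 * (n * w - x * X - y * Y - z * Z)"
  define w' where "w' = a * w + b"
  define D where "D = (x - w * X) ^ 2 + (y - w * Y) ^ 2 + (z - w * Z) ^ 2"
  have "4 * D \<le> 3 * w ^ 2" 
  proof -
    have "4 * (a + b + c) \<le> 3 * d" if "4 * a \<le> d" "4 * b \<le> d" "4 * c \<le> d" for a b c d :: int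
      using add_mono[OF add_mono[OF that(1,2)] that(3)] by simp
    from this[OF XYZ[THEN sq]] show ?thesis by (simp only: D_def)
  qed
  have D: "w * w' = D"
  proof -
    have "D = (x ^ 2 + y ^ 2 + z ^ 2) - 2 * w * (x * X + y * Y + z * Z) + w ^ 2 * (X ^ 2 + Y ^ 2 + Z ^ 2)"
      unfolding D_def by (simp add: power2_eq_square algebra_simps)
    then show ?thesis unfolding less.prems(2)[symmetric] w'_def a_def b_def
      by (simp add: power2_eq_square algebra_simps)
  qed
  show ?case
  proof (cases "D = 0")
    case True
    then have "x = w * X" "y = w * Y" "z = w * Z"
      unfolding D_def by (smt (verit) zero_le_power2 zero_eq_power2)+
    then have "w ^ 2 * n = w ^ 2 * (X ^ 2 + Y ^ 2 + Z ^ 2)"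
      using less.prems(2) by (simp add: power_mult_distrib algebra_simps)
    then show ?thesis using less.prems(1) by auto
  next
    case False
    moreover have "0 \<le> D" by (simp add: D_def)
    ultimately have "0 < w'" using D less.prems(1) by (metis less_le zero_less_mult_pos)
    have "w * w' < w * w"
    proof -
      have "0 < w * w" using less.prems(1) by simp
      then have "D < w * w" using \<open>4 * D \<le> 3 * w ^ 2\<close> unfolding power2_eq_square by linarith
      then show ?thesis unfolding D .
    qed
    then have "w' < w" using less.prems(1) by simp
    have "n * w' ^ 2 = (a * x + b * X) ^ 2 + (a * y + b * Y) ^ 2 + (a * z + b * Z) ^ 2"
    proof -
      have "(a * x + b * X) ^ 2 + (a * y + b * Y) ^ 2 + (a * z + b * Z) ^ 2
         = a ^ 2 * (x ^ 2 + y ^ 2 + z ^ 2) + a * b * (2 * (x * X + y * Y + z * Z)) + b ^ 2 * (X ^ 2 + Y ^ 2 + Z ^ 2)"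
        by (simp add: power2_eq_square algebra_simps)
      also have "\<dots> = a ^ 2 * (n * w ^ 2) + a * b * (2 * n * w - b) + b ^ 2 * (a + n)"
        unfolding less.prems(2)[symmetric] by (simp add: b_def a_def)
      also have "\<dots> = n * w' ^ 2" unfolding w'_def by (simp add: power2_eq_square algebra_simps)
      finally show ?thesis by simp
    qed
    then show ?thesis
      using less.hyps[of w'] \<open>0 < w'\<close> \<open>w' < w\<close> by (metis less.prems(1) nat_mono_iff)
  qed
qed

section \<open>Legendre symbols\<close>

lemma Legendre_cases: "Legendre a p \<in> {-1, 0, 1}"
  by (simp add: Legendre_def)

lemma Legendre_eq_0_iff: "Legendre a p = 0 \<longleftrightarrow> p dvd a"
  by (simp add: Legendre_def cong_0_iff)

lemma Legendre_eq_1_iff: "Legendre a p = 1 \<longleftrightarrow> \<not> p dvd a \<and> (\<exists>y. p dvd y ^ 2 - a)"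
  by (simp add: Legendre_def cong_0_iff QuadRes_def cong_iff_dvd_diff)

lemma Legendre_cong: "[a = b] (mod p) \<Longrightarrow> Legendre a p = Legendre b p"
proof -
  assume ab: "[a = b] (mod p)"
  then have "[x = a] (mod p) \<longleftrightarrow> [x = b] (mod p)" "[a = x] (mod p) \<longleftrightarrow> [b = x] (mod p)" for x
    by (auto simp: cong_def)
  then show ?thesis by (simp add: Legendre_def QuadRes_def)
qed

lemma sign_eq_of_cong:
  fixes a b p :: int
  assumes "2 < p" "a \<in> {-1, 0, 1}" "b \<in> {-1, 0, 1}" "[a = b] (mod p)"
  shows "a = b"
proof -
  have "p dvd a - b" using assms(4) by (simp add: cong_iff_dvd_diff)
  moreover have "\<bar>a - b\<bar> < p" using assms by auto
  ultimately show ?thesis using zdvd_imp_le[of p "\<bar>a - b\<bar>"] by fastforce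
qed

lemma Legendre_mult:
  assumes "prime p" "2 < p"
  shows "Legendre (a * b) (int p) = Legendre a (int p) * Legendre b (int p)"
proof (rule sign_eq_of_cong)
  have "[Legendre (a * b) p = a ^ ((p - 1) div 2) * b ^ ((p - 1) div 2)] (mod p)"
    using euler_criterion[OF assms, of "a * b"] by (simp add: power_mult_distrib)
  moreover have "[Legendre a p * Legendre b p = a ^ ((p - 1) div 2) * b ^ ((p - 1) div 2)] (mod p)"
    using euler_criterion[OF assms] by (intro cong_mult)
  ultimately show "[Legendre (a * b) p = Legendre a p * Legendre b p] (mod p)"
    by (meson cong_sym cong_trans)
  show "Legendre a p * Legendre b p \<in> {-1, 0, 1}"
    using Legendre_cases[of a p] Legendre_cases[of b p] by auto
qed (use assms Legendre_cases in auto)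

lemma Legendre_one: "1 < p \<Longrightarrow> Legendre 1 p = 1"
  unfolding Legendre_eq_1_iff by (auto intro: exI[of _ 1])

lemma Legendre_minus_1:
  assumes "prime p" "2 < p"
  shows "Legendre (-1) (int p) = (if p mod 4 = 1 then 1 else -1)"
proof (rule sign_eq_of_cong)
  have "odd p" using assms prime_odd_nat by blast
  then have "even ((p - 1) div 2) \<longleftrightarrow> p mod 4 = 1" by presburger
  then have "(-1) ^ ((p - 1) div 2) = (if p mod 4 = 1 then 1 else -1 :: int)" by simp
  then show "[Legendre (-1) (int p) = (if p mod 4 = 1 then 1 else -1)] (mod (int p))"
    using euler_criterion[OF assms, of "-1"] by simp
qed (use assms Legendre_cases in auto)

text \<open>Gauss's lemma with multiplier 2: for \<open>x \<le> (p - 1) div 2\<close> the number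
  \<open>2 * x\<close> is already reduced modulo \<open>p\<close>, so the residues counted in
  \<open>E\<close> come exactly from \<open>x > (p - 1) div 4\<close>.\<close>

lemma Legendre_2:
  assumes "prime p" "2 < p"
  shows "Legendre 2 (int p) = (if p mod 8 = 1 \<or> p mod 8 = 7 then 1 else -1)"
proof -
  have odd: "odd p" using assms prime_odd_nat by blast
  interpret GAUSS p 2
    using assms by unfold_locales (auto simp: cong_0_iff dest: zdvd_imp_le)
  have "E = (\<lambda>x. 2 * x) ` {(int p - 1) div 4 <.. (int p - 1) div 2}"
  proof (intro equalityI subsetI)
    fix y assume "y \<in> E"
    then obtain x where x: "0 < x" "x \<le> (int p - 1) div 2" "y = x * 2 mod int p" "(int p - 1) div 2 < y"
      by (auto simp: E_def C_def B_def A_def)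
    then have "y = 2 * x" using odd by (subst x(3), subst mod_pos_pos_trivial) auto
    moreover from this x have "(int p - 1) div 4 < x" by linarith
    ultimately show "y \<in> (\<lambda>x. 2 * x) ` {(int p - 1) div 4 <.. (int p - 1) div 2}" using x by auto
  next
    fix y assume "y \<in> (\<lambda>x. 2 * x) ` {(int p - 1) div 4 <.. (int p - 1) div 2}"
    then obtain x where x: "y = 2 * x" "(int p - 1) div 4 < x" "x \<le> (int p - 1) div 2" by auto
    have "0 < x" using x(2) assms by linarith
    moreover have "x * 2 mod int p = y" using x \<open>0 < x\<close> odd by (subst mod_pos_pos_trivial) auto
    moreover have "(int p - 1) div 2 < y" using x odd by presburger
    ultimately have "y \<in> (\<lambda>x. x * 2 mod int p) ` A"
      using x \<open>0 < x\<close> by (intro image_eqI[of _ _ x]) (auto simp: A_def)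
    with \<open>(int p - 1) div 2 < y\<close> show "y \<in> E" by (auto simp: E_def C_def B_def image_image)
  qed
  then have "card E = nat ((int p - 1) div 2 - (int p - 1) div 4)"
    by (simp add: card_image inj_on_def)
  also have "(int p - 1) div 2 - (int p - 1) div 4 = int ((p - 1) div 2 - (p - 1) div 4)"
    using assms by (simp add: of_nat_diff zdiv_int div_le_mono2)
  finally have c: "card E = (p - 1) div 2 - (p - 1) div 4"
    by (simp only: nat_int)
  have "even ((p - 1) div 2 - (p - 1) div 4) \<longleftrightarrow> p mod 8 = 1 \<or> p mod 8 = 7"
  proof -
    define k where "k = p div 8"
    have "p = 8 * k + p mod 8" by (simp add: k_def)
    moreover have "p mod 8 = 1 \<or> p mod 8 = 3 \<or> p mod 8 = 5 \<or> p mod 8 = 7" using odd by presburger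
    ultimately consider "p = 8 * k + 1" | "p = 8 * k + 3" | "p = 8 * k + 5" | "p = 8 * k + 7" by metis
    then show ?thesis
    proof cases
      case 1
      then have "(p - 1) div 2 - (p - 1) div 4 = 2 * k" "p mod 8 = 1" by simp_all
      then show ?thesis by simp
    next
      case 2
      then have "(p - 1) div 2 - (p - 1) div 4 = 2 * k + 1" "p mod 8 = 3" by simp_all
      then show ?thesis by simp
    next
      case 3
      then have "(p - 1) div 2 - (p - 1) div 4 = 2 * k + 1" "p mod 8 = 5" by simp_all
      then show ?thesis by simp
    next
      case 4
      then have "(p - 1) div 2 - (p - 1) div 4 = 2 * (k + 1)" "p mod 8 = 7" by simp_all
      then show ?thesis by simp
    qed
  qed
  then show ?thesis using gauss_lemma c by simp
qed

text \<open>Otherwise squaring would be surjective, hence injective, on the residues modulo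
  \<open>p\<close>; but 1 and \<open>p - 1\<close> have the same square.\<close>

lemma exists_nonresidue:
  assumes "prime p" "2 < p"
  obtains a :: nat where "Legendre (int a) (int p) = -1"
proof -
  have "\<exists>a. Legendre (int a) (int p) = -1"
  proof (rule ccontr)
    assume contra: "\<nexists>a. Legendre (int a) (int p) = -1"
    let ?g = "\<lambda>y. y ^ 2 mod p"
    have "{..<p} \<subseteq> ?g ` {..<p}"
    proof
      fix a assume a: "a \<in> {..<p}"
      then have "Legendre (int a) (int p) = 0 \<or> Legendre (int a) (int p) = 1"
        using contra Legendre_cases[of "int a" "int p"] by blast
      then have "\<exists>y. int p dvd y ^ 2 - int a"
        unfolding Legendre_eq_0_iff Legendre_eq_1_iff by (auto intro: exI[of _ 0])
      then obtain y where "[y ^ 2 = int a] (mod int p)" by (auto simp: cong_iff_dvd_diff)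
      then have "(y mod int p) ^ 2 mod int p = int a"
        using a by (simp add: cong_def power_mod)
      moreover define z where "z = nat (y mod int p)"
      moreover have "int z = y mod int p" "z < p" using assms by (auto simp: z_def nat_less_iff)
      ultimately have "int (z ^ 2 mod p) = int a" by (simp add: zmod_int)
      then have "z ^ 2 mod p = a" by linarith
      then show "a \<in> ?g ` {..<p}" using \<open>z < p\<close> by auto
    qed
    then have "inj_on ?g {..<p}"
      using card_mono[of "?g ` {..<p}" "{..<p}"] card_image_le[of "{..<p}" ?g]
      by (intro eq_card_imp_inj_on) auto
    moreover have "?g 1 = ?g (p - 1)"
    proof -
      have "[(int p - 1) ^ 2 = 1] (mod int p)"
        by (simp add: cong_iff_dvd_diff power2_eq_square algebra_simps)
      then have "[(p - 1) ^ 2 = 1] (mod p)"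
        using assms by (simp add: of_nat_diff flip: cong_int_iff)
      then show ?thesis by (simp add: cong_def)
    qed
    ultimately have "1 = p - 1" by (rule inj_onD) (use assms in simp_all)
    then show False using assms by simp
  qed
  then show ?thesis using that by blast
qed

text \<open>Multiplication by \<open>u\<close> permutes the residues modulo \<open>N\<close> and
  flips the sign of the sum.\<close>

lemma periodic_character_sum_zero:
  fixes \<chi> :: "nat \<Rightarrow> real"
  assumes "0 < N" and period: "\<And>n. \<chi> (n mod N) = \<chi> n" and mult: "\<And>m n. \<chi> (m * n) = \<chi> m * \<chi> n"
    and u: "coprime u N" "\<chi> u = -1"
  shows "(\<Sum>k<N. \<chi> k) = 0"
proof -
  have inj: "inj_on (\<lambda>k. u * k mod N) {..<N}"
  proof (rule inj_onI)
    fix x y assume xy: "x \<in> {..<N}" "y \<in> {..<N}" "u * x mod N = u * y mod N"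
    then have "[x = y] (mod N)" using u(1) cong_mult_lcancel_nat[of u N x y] by (simp add: cong_def)
    then show "x = y" using xy by (simp add: cong_def)
  qed
  have "(\<lambda>k. u * k mod N) ` {..<N} = {..<N}"
    using inj \<open>0 < N\<close> by (intro card_subset_eq) (auto simp: card_image)
  then have "(\<Sum>k<N. \<chi> k) = (\<Sum>k<N. \<chi> (u * k mod N))"
    using sum.reindex[OF inj, of \<chi>] by simp
  also have "\<dots> = - (\<Sum>k<N. \<chi> k)" by (simp add: period mult u(2) sum_negf)
  finally show ?thesis by simp
qed

text \<open>Complete periods cancel, so the sums from 0 stay within \<open>N\<close>; the extra 1
  pays for the term at 0, which the locale leaves out.\<close>

lemma real_characterI:
  fixes \<chi> :: "nat \<Rightarrow> real"
  assumes "0 < N" and period: "\<And>n. \<chi> (n mod N) = \<chi> n" and mult: "\<And>m n. \<chi> (m * n) = \<chi> m * \<chi> n"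
    and one: "\<chi> 1 = 1" and vals: "\<And>n. \<chi> n \<in> {-1, 0, 1}"
    and u: "coprime u N" "\<chi> u = -1"
  shows "real_character \<chi> (real N + 1)"
proof
  have le1: "\<bar>\<chi> n\<bar> \<le> 1" for n using vals[of n] by auto
  have bd: "\<bar>\<Sum>k<n. \<chi> k\<bar> \<le> real N" for n
  proof (induction n rule: less_induct)
    case (less n)
    show ?case
    proof (cases "n \<le> N")
      case True
      have "\<bar>\<Sum>k<n. \<chi> k\<bar> \<le> (\<Sum>k<n. 1)" by (rule order_trans[OF sum_abs sum_mono[OF le1]])
      then show ?thesis using True by simp
    next
      case False
      then obtain m where m: "n = N + m" by (metis le_Suc_ex nat_le_linear)
      have "\<chi> (N + k) = \<chi> k" for k by (metis period mod_add_self1)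
      then have "(\<Sum>k<n. \<chi> k) = (\<Sum>k<m. \<chi> k)"
        using periodic_character_sum_zero[OF assms(1-3) u]
        unfolding m by (induction m) simp_all
      then show ?thesis using less.IH[of m] m \<open>0 < N\<close> by simp
    qed
  qed
  show "\<bar>\<Sum>k=1..<n. \<chi> k\<bar> \<le> real N + 1" for n
  proof (cases "n = 0")
    case False
    then have "(\<Sum>k<n. \<chi> k) = \<chi> 0 + (\<Sum>k=1..<n. \<chi> k)"
      by (simp add: lessThan_atLeast0 sum.atLeast_Suc_lessThan)
    then show ?thesis using bd[of n] le1[of 0] by linarith
  qed simp
qed (use assms in auto)

text \<open>\<open>\<chi>4\<close> and \<open>\<chi>8\<close> extend the symbols (-1/p) and (2/p),
  as functions of the odd prime p, to characters modulo 8.\<close>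

definition \<chi>4 :: "nat \<Rightarrow> int" where
  "\<chi>4 n = (if n mod 4 = 1 then 1 else if n mod 4 = 3 then -1 else 0)"

definition \<chi>8 :: "nat \<Rightarrow> int" where
  "\<chi>8 n = (if n mod 8 = 1 \<or> n mod 8 = 7 then 1 else if n mod 8 = 3 \<or> n mod 8 = 5 then -1 else 0)"

lemma \<chi>4_mod: "\<chi>4 (n mod 8) = \<chi>4 n" and \<chi>8_mod: "\<chi>8 (n mod 8) = \<chi>8 n"
  by (simp_all add: \<chi>4_def \<chi>8_def mod_mod_cancel)

lemma lessThan_8: "{..<8} = {0, 1, 2, 3, 4, 5, 6, 7::nat}"
  by (auto simp: less_Suc_eq numeral_eq_Suc)

lemma \<chi>4_mult: "\<chi>4 (m * n) = \<chi>4 m * \<chi>4 n" and \<chi>8_mult: "\<chi>8 (m * n) = \<chi>8 m * \<chi>8 n"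
proof -
  have *: "\<forall>i\<in>{..<8}. \<forall>j\<in>{..<8}. \<chi>4 (i * j) = \<chi>4 i * \<chi>4 j \<and> \<chi>8 (i * j) = \<chi>8 i * \<chi>8 j"
    unfolding lessThan_8 by (simp add: \<chi>4_def \<chi>8_def)
  have "\<chi>4 (m mod 8 * (n mod 8)) = \<chi>4 (m mod 8) * \<chi>4 (n mod 8)"
    "\<chi>8 (m mod 8 * (n mod 8)) = \<chi>8 (m mod 8) * \<chi>8 (n mod 8)"
    using * by auto
  moreover have "\<chi>4 (m mod 8 * (n mod 8)) = \<chi>4 (m * n)" "\<chi>8 (m mod 8 * (n mod 8)) = \<chi>8 (m * n)"
    by (metis \<chi>4_mod \<chi>8_mod mod_mult_eq)+
  ultimately show "\<chi>4 (m * n) = \<chi>4 m * \<chi>4 n" "\<chi>8 (m * n) = \<chi>8 m * \<chi>8 n"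
    by (simp_all add: \<chi>4_mod \<chi>8_mod)
qed

text \<open>The indices 4 and 8 are not primes, so they are free to name the two characters modulo 8.\<close>

definition qchar :: "nat \<Rightarrow> nat \<Rightarrow> int" where
  "qchar i n = (if i = 4 then \<chi>4 n else if i = 8 then \<chi>8 n else Legendre (int n) (int i))"

lemma prod_sign: "(\<And>i. i \<in> J \<Longrightarrow> f i \<in> {-1, 0, 1 :: 'a :: idom}) \<Longrightarrow> (\<Prod>i\<in>J. f i) \<in> {-1, 0, 1}"
proof (induction J rule: infinite_finite_induct)
  case (insert i J)
  then have "f i \<in> {-1, 0, 1}" "prod f J \<in> {-1, 0, 1}" by blast+
  then show ?case using insert.hyps by auto
qed auto

lemma prod_eq_minus_1:
  assumes "finite J" "i \<in> J" "f i = -1" "\<And>j. j \<in> J \<Longrightarrow> j \<noteq> i \<Longrightarrow> f j = (1 :: 'a :: comm_ring_1)"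
  shows "(\<Prod>j\<in>J. f j) = -1"
  using assms by (subst prod.remove[of _ i]) (auto intro!: prod.neutral)

text \<open>What has to be shown is that every product over a nonempty set of these characters is
  nontrivial. Given \<open>i\<close> in the set, the Chinese remainder theorem yields a
  \<open>u\<close> at which character \<open>i\<close> is -1 and all others are 1. The primes in
  \<open>insert 2 P\<close> are excluded because some character vanishes there.\<close>

theorem prime_with_prescribed_legendre:
  assumes P: "finite P" "\<And>p. p \<in> P \<Longrightarrow> prime p \<and> 2 < p"
    and eps: "\<And>p. p \<in> P \<Longrightarrow> \<epsilon> p \<in> {-1, 1}"
    and \<delta>: "\<delta> \<in> {-1, 1 :: int}"
  obtains q where "prime q" "q \<notin> P" "q mod 4 = 1" "\<chi>8 q = \<delta>"
    "\<And>p. p \<in> P \<Longrightarrow> Legendre (int q) (int p) = \<epsilon> p"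
proof -
  define I where "I = insert 4 (insert 8 P)"
  define e where "e i = (if i = 4 then 1 else if i = 8 then \<delta> else \<epsilon> i)" for i
  have np: "4 \<notin> P" "8 \<notin> P"
    using P(2)[of 4] P(2)[of 8] prime_odd_nat[of 4] prime_odd_nat[of 8] by auto
  have "\<exists>q. prime q \<and> q \<notin> insert 2 P \<and> (\<forall>i\<in>I. real_of_int (qchar i q) = real_of_int (e i))"
  proof (rule prime_with_prescribed_characters)
    show "finite I" "finite (insert 2 P)" using P by (auto simp: I_def)
    show "real_of_int (e i) \<in> {- 1, 1}" if "i \<in> I" for i
    proof -
      have "e i \<in> {- 1, 1}" using that eps \<delta> by (auto simp: I_def e_def)
      then show ?thesis by auto
    qed
    show "real_of_int (qchar i p) \<noteq> 0" if "prime p" "p \<notin> insert 2 P" "i \<in> I" for p i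
    proof -
      have "odd p" using that prime_odd_nat prime_ge_2_nat[of p] by fastforce
      then have "\<chi>4 p \<noteq> 0" "\<chi>8 p \<noteq> 0" unfolding \<chi>4_def \<chi>8_def by presburger+
      moreover have "Legendre (int p) (int i) \<noteq> 0" if "i \<in> P"
        using P(2)[OF that] \<open>prime p\<close> \<open>p \<notin> insert 2 P\<close> that primes_dvd_imp_eq[of i p]
        by (auto simp: Legendre_eq_0_iff)
      ultimately show ?thesis using \<open>i \<in> I\<close> by (auto simp: qchar_def I_def)
    qed
    show "\<exists>B. real_character (\<lambda>n. \<Prod>i\<in>J. real_of_int (qchar i n)) B" if J: "J \<subseteq> I" "J \<noteq> {}" for J
    proof -
      define N where "N = 8 * \<Prod>P"
      have finJ: "finite J" using J P by (auto simp: I_def intro: finite_subset)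
      have N: "0 < N" using P prime_gt_0_nat by (auto simp: N_def intro!: prod_pos)
      obtain i where i: "i \<in> J" using J by blast
      have "\<exists>g. \<forall>p\<in>P. (p = i \<longrightarrow> Legendre (int (g p)) (int p) = -1) \<and> (p \<noteq> i \<longrightarrow> g p = (1::nat))"
      proof (rule bchoice, rule ballI)
        fix p assume "p \<in> P"
        then obtain a :: nat where "Legendre (int a) (int p) = -1"
          using exists_nonresidue[of p] P(2)[of p] by blast
        then show "\<exists>g. (p = i \<longrightarrow> Legendre (int g) (int p) = -1) \<and> (p \<noteq> i \<longrightarrow> g = (1::nat))"
          by (cases "p = i") auto
      qed
      then obtain g where g: "\<And>p. p \<in> P \<Longrightarrow> p = i \<Longrightarrow> Legendre (int (g p)) (int p) = -1"
        "\<And>p. p \<in> P \<Longrightarrow> p \<noteq> i \<Longrightarrow> g p = (1::nat)" by metis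
      \<comment> \<open>Modulo 8, the residue 7 flips only \<open>\<chi>4\<close> and the residue 5
        flips only \<open>\<chi>8\<close>.\<close>
      define h where "h p = (if p = 8 then (if i = 4 then 7 else if i = 8 then 5 else 1) else g p)" for p
      have cop: "\<forall>a\<in>insert 8 P. \<forall>b\<in>insert 8 P. a \<noteq> b \<longrightarrow> coprime a b"
      proof -
        have "coprime (2 ^ 3) p" if "p \<in> P" for p
          using P(2)[OF that] prime_odd_nat[of p] by (subst coprime_power_left_iff) simp
        then show ?thesis using P(2) by (auto intro: primes_coprime simp: coprime_commute)
      qed
      have "\<exists>u. \<forall>p\<in>insert 8 P. [u = h p] (mod p)"
        by (rule chinese_remainder_nat[OF _ cop]) (use P(1) in simp)
      then obtain u where u: "\<And>p. p \<in> insert 8 P \<Longrightarrow> [u = h p] (mod p)" by blast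
      have u8: "u mod 8 = (if i = 4 then 7 else if i = 8 then 5 else 1)"
        using u[of 8] by (auto simp: cong_def h_def)
      have uP: "Legendre (int u) (int p) = (if p = i then -1 else 1)" if "p \<in> P" for p
      proof -
        have "[int u = int (g p)] (mod int p)"
        proof -
          have "p \<noteq> 8" using that np by blast
          then show ?thesis using u[of p] that by (simp add: h_def cong_int_iff)
        qed
        then have "Legendre (int u) (int p) = Legendre (int (g p)) (int p)" by (rule Legendre_cong)
        then show ?thesis using g[OF that] P(2)[OF that] by (auto simp: Legendre_one)
      qed
      have qu: "qchar j u = (if j = i then -1 else 1)" if "j \<in> I" for j
      proof -
        have "u mod 4 = (u mod 8) mod 4" by (simp add: mod_mod_cancel)
        then have "\<chi>4 u = (if i = 4 then -1 else 1)" "\<chi>8 u = (if i = 8 then -1 else 1)"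
          using u8 by (auto simp: \<chi>4_def \<chi>8_def)
        then show ?thesis using uP that np by (auto simp: qchar_def I_def)
      qed
      have "coprime u N"
      proof -
        have "odd u" using u8 by (auto split: if_splits; presburger)
        then have "coprime u 8" using coprime_power_right_iff[of u 2 3] by simp
        moreover have "coprime u p" if "p \<in> P" for p
        proof -
          have "\<not> p dvd u" using uP[OF that] Legendre_eq_0_iff[of "int u" "int p"] by (auto split: if_splits)
          then show ?thesis using P(2)[OF that] prime_imp_coprime[of p u] by (simp add: coprime_commute)
        qed
        ultimately show ?thesis unfolding N_def by (auto intro: prod_coprime_right)
      qed
      have "real_character (\<lambda>n. real_of_int (\<Prod>i\<in>J. qchar i n)) (real N + 1)"
      proof (rule real_characterI[OF N _ _ _ _ \<open>coprime u N\<close>])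
        have per: "qchar j (n mod N) = qchar j n" if "j \<in> I" for j n
        proof -
          have "\<chi>4 (n mod N) = \<chi>4 n" "\<chi>8 (n mod N) = \<chi>8 n"
            using \<chi>4_mod[of "n mod N"] \<chi>8_mod[of "n mod N"] \<chi>4_mod[of n] \<chi>8_mod[of n]
            by (simp_all add: N_def mod_mod_cancel)
          moreover have "Legendre (int (n mod N)) (int j) = Legendre (int n) (int j)" if "j \<in> P"
          proof (rule Legendre_cong)
            have "j dvd N" using that P(1) by (auto simp: N_def intro: dvd_mult dvd_prodI)
            then have "[n mod N = n] (mod j)" by (simp add: cong_def mod_mod_cancel)
            then show "[int (n mod N) = int n] (mod int j)" by (simp only: cong_int_iff)
          qed
          ultimately show ?thesis using \<open>j \<in> I\<close> by (auto simp: qchar_def I_def)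
        qed
        show "real_of_int (\<Prod>i\<in>J. qchar i (n mod N)) = real_of_int (\<Prod>i\<in>J. qchar i n)" for n
          using per J by (intro arg_cong[of _ _ real_of_int] prod.cong) auto
        have mult: "qchar j (m * n) = qchar j m * qchar j n" if "j \<in> I" for j m n
          using that P(2)[of j] by (auto simp: qchar_def I_def \<chi>4_mult \<chi>8_mult Legendre_mult)
        show "real_of_int (\<Prod>i\<in>J. qchar i (m * n))
            = real_of_int (\<Prod>i\<in>J. qchar i m) * real_of_int (\<Prod>i\<in>J. qchar i n)" for m n
        proof -
          have "(\<Prod>i\<in>J. qchar i (m * n)) = (\<Prod>i\<in>J. qchar i m * qchar i n)"
            using mult J by (intro prod.cong) auto
          then show ?thesis by (simp add: prod.distrib)
        qed
        have "qchar j 1 = 1" if "j \<in> I" for j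
          using that P(2)[of j] by (auto simp: qchar_def I_def \<chi>4_def \<chi>8_def Legendre_one)
        then have "(\<Prod>i\<in>J. qchar i 1) = 1" using J by (intro prod.neutral) auto
        then show "real_of_int (\<Prod>i\<in>J. qchar i 1) = 1" by (simp only: of_int_1)
        show "real_of_int (\<Prod>i\<in>J. qchar i n) \<in> {- 1, 0, 1}" for n
        proof -
          have "(\<Prod>i\<in>J. qchar i n) \<in> {-1, 0, 1}"
            by (rule prod_sign) (use Legendre_cases in \<open>auto simp: qchar_def \<chi>4_def \<chi>8_def\<close>)
          then show ?thesis by (auto simp del: of_int_prod)
        qed
        have "(\<Prod>j\<in>J. qchar j u) = -1"
          by (rule prod_eq_minus_1[OF finJ i]) (use qu J i in auto)
        then show "real_of_int (\<Prod>i\<in>J. qchar i u) = - 1" by (simp only: of_int_minus of_int_1)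
      qed
      then show ?thesis by (auto simp: of_int_prod)
    qed
  qed
  then obtain q where q: "prime q" "q \<notin> insert 2 P" "\<And>i. i \<in> I \<Longrightarrow> qchar i q = e i"
    by (auto simp: of_int_eq_iff)
  have "\<chi>4 q = 1" "\<chi>8 q = \<delta>" using q(3)[of 4] q(3)[of 8] by (auto simp: qchar_def I_def e_def)
  moreover have "Legendre (int q) (int p) = \<epsilon> p" if "p \<in> P" for p
  proof -
    have "p \<noteq> 4" "p \<noteq> 8" "p \<in> I" using that np by (auto simp: I_def)
    then show ?thesis using q(3)[of p] by (simp add: qchar_def e_def)
  qed
  ultimately show ?thesis using q that by (auto simp: \<chi>4_def split: if_splits)
qed

text \<open>Thue's argument again, with the third coordinate switched off: a short vector with
  \<open>x = r * t\<close> modulo \<open>q\<close>, where \<open>r ^ 2 = -1\<close>, makes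
  \<open>x ^ 2 + t ^ 2\<close> a positive multiple of \<open>q\<close> below
  \<open>2 * q\<close>.\<close>

lemma sum_two_squares_prime:
  assumes q: "prime q" "q mod 4 = 1"
  obtains a b where "int q = a ^ 2 + b ^ 2"
proof -
  have "2 < q" using assms prime_ge_2_nat[of q] by (cases "q = 2") auto
  then have "Legendre (-1) (int q) = 1" using Legendre_minus_1[OF q(1)] q(2) by simp
  then obtain r where r: "int q dvd r ^ 2 + 1" by (auto simp: Legendre_eq_1_iff)
  define A where "A = nat \<lfloor>sqrt (real_of_int (int q))\<rfloor>"
  have nonsq: "y ^ 2 \<noteq> int q" for y :: int
  proof
    assume y: "y ^ 2 = int q"
    then have "int q dvd y" using q(1) by (metis dvd_refl prime_dvd_power prime_int_nat_transfer prime_nat_int_transfer)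
    then obtain k where "y = int q * k" by (elim dvdE)
    then have "int q * (int q * k ^ 2) = int q * 1" using y by (simp add: power2_eq_square algebra_simps)
    then have "int q * k ^ 2 = 1" using \<open>2 < q\<close> by (subst (asm) mult_cancel_left) auto
    then have "int q dvd 1" by (metis dvd_triv_left)
    then show False using \<open>2 < q\<close> by simp
  qed
  have "real_of_int (int q) < real ((A + 1) * (A + 1))"
  proof -
    have "sqrt (real_of_int (int q)) < real (A + 1)" unfolding A_def by (rule sqrt_less_Suc_floor)
    then have "sqrt (real_of_int (int q)) * sqrt (real_of_int (int q)) < real (A + 1) * real (A + 1)"
      by (intro mult_strict_mono) auto
    then show ?thesis by (simp only: of_nat_mult) simp
  qed
  then have "q < (A + 1) * (A + 1)" by (simp only: of_int_of_nat_eq of_nat_less_iff)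
  then have big: "int q < int ((A + 1) * (A + 1) * (0 + 1))"
    by (simp only: of_nat_less_iff mult_1_right add_0)
  obtain x t w where "(x, t, w) \<noteq> (0, 0, 0)" "int q dvd x - r * t - 0 * w"
    "\<bar>x\<bar> \<le> int A" "\<bar>t\<bar> \<le> int A" "\<bar>w\<bar> \<le> int 0"
    by (rule finite_pigeonhole_lattice[OF _ big, of r 0]) (use \<open>2 < q\<close> in auto)
  then have xt: "x \<noteq> 0 \<or> t \<noteq> 0" "int q dvd x - r * t" "\<bar>x\<bar> \<le> int A" "\<bar>t\<bar> \<le> int A" by auto
  then have bd: "x ^ 2 \<le> int q" "t ^ 2 \<le> int q"
    by (auto intro!: power2_le_of_abs_le_floor_sqrt simp: A_def)
  have "int q dvd (x - r * t) * (x + r * t) + (r ^ 2 + 1) * t ^ 2"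
    by (rule dvd_add[OF dvd_mult2[OF xt(2)] dvd_mult2[OF r]])
  then have "int q dvd x ^ 2 + t ^ 2" by (simp add: algebra_simps power2_eq_square)
  then obtain k where k: "x ^ 2 + t ^ 2 = int q * k" by (elim dvdE)
  have "0 < x ^ 2 + t ^ 2" using xt(1) by (simp add: sum_power2_gt_zero_iff)
  moreover have "x ^ 2 + t ^ 2 < int q * 2" using bd nonsq[of x] by linarith
  ultimately have "0 < k" "k < 2" using \<open>2 < q\<close> unfolding k by (simp_all add: zero_less_mult_iff)
  then show ?thesis using k by (intro that[of x t]) simp
qed

section \<open>Three squares, first for squarefree integers\<close>

lemma quadratic_residue_prod:
  fixes c :: int
  assumes "finite P" "\<And>p. p \<in> P \<Longrightarrow> prime p" "\<And>p. p \<in> P \<Longrightarrow> \<exists>r. int p dvd r ^ 2 - c"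
  shows "\<exists>r. int (\<Prod>P) dvd r ^ 2 - c"
  using assms
proof (induction P)
  case (insert p P)
  then obtain r1 r2 where r: "int p dvd r1 ^ 2 - c" "int (\<Prod>P) dvd r2 ^ 2 - c" by blast
  have "coprime p (\<Prod>P)"
  proof (rule prod_coprime_right)
    fix x assume "x \<in> P"
    then have "p \<noteq> x" "prime p" "prime x" using insert.hyps insert.prems by auto
    then show "coprime p x" by (intro primes_coprime)
  qed
  then have cop: "coprime (int p) (int (\<Prod>P))" by (simp only: coprime_int_iff)
  obtain x where x: "int p dvd x - r1" "int (\<Prod>P) dvd x - r2" using crt_int[OF cop] .
  have lift: "d dvd x ^ 2 - c" if "d dvd x - y" "d dvd y ^ 2 - c" for d y
  proof -
    have "d dvd (x - y) * (x + y) + (y ^ 2 - c)" using that by (intro dvd_add dvd_mult2)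
    then show ?thesis by (simp add: algebra_simps power2_eq_square)
  qed
  have "int p * int (\<Prod>P) dvd x ^ 2 - c"
    using cop lift x r by (intro divides_mult) auto
  then show ?case using insert.hyps by auto
qed simp

lemma squarefree_eq_prod_prime_factors:
  fixes n :: nat
  assumes "squarefree n"
  shows "n = \<Prod>(prime_factors n)"
proof -
  have "n \<noteq> 0" using assms by (cases "n = 0") auto
  have "multiplicity p n = 1" if "p \<in> prime_factors n" for p
    using that assms \<open>n \<noteq> 0\<close>
    by (auto simp: squarefree_factorial_semiring'' prime_factors_multiplicity le_Suc_eq)
  then have "(\<Prod>p\<in>prime_factors n. p ^ multiplicity p n) = \<Prod>(prime_factors n)"
    by (intro prod.cong) auto
  then show ?thesis using prime_factorization_nat[of n] \<open>n \<noteq> 0\<close> by simp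
qed

lemma three_squares_via_prime:
  fixes n q u :: nat
  assumes n: "squarefree n" and q: "prime q" "q mod 4 = 1" "\<not> q dvd n"
    and u: "u = 1 \<or> u = 2 \<and> odd n"
    and res: "\<And>p. prime p \<Longrightarrow> 2 < p \<Longrightarrow> p dvd n \<Longrightarrow> Legendre (- int (u * q)) (int p) = 1"
    and nq: "Legendre (int n) (int q) = 1"
  shows "\<exists>x y z. int n = x ^ 2 + y ^ 2 + z ^ 2"
proof -
  have q2: "2 < q" using q prime_ge_2_nat[of q] by (cases "q = 2") auto
  define Q where "Q = int (u * q)"
  have n0: "0 < n" using n by (cases "n = 0") auto
  have "\<exists>r. int (\<Prod>(prime_factors n)) dvd r ^ 2 - (- Q)"
  proof (rule quadratic_residue_prod)
    fix p assume p: "p \<in> prime_factors n"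
    then have pp: "prime p" "p dvd n" by auto
    show "\<exists>r. int p dvd r ^ 2 - (- Q)"
    proof (cases "p = 2")
      case True
      have "even (Q ^ 2 + Q)" by simp
      then show ?thesis using True by (intro exI[of _ Q]) simp
    next
      case False
      then have "Legendre (- Q) (int p) = 1"
        using res[of p] pp prime_ge_2_nat[of p] unfolding Q_def by simp
      then show ?thesis by (simp add: Legendre_eq_1_iff)
    qed
  qed auto
  then obtain r where r: "int n dvd r ^ 2 + Q"
    using squarefree_eq_prod_prime_factors[OF n] by auto
  obtain s0 where s0: "int q dvd s0 ^ 2 - int n" using nq by (auto simp: Legendre_eq_1_iff)
  have "\<exists>s. Q dvd s ^ 2 - int n"
  proof (cases "u = 1")
    case True
    then show ?thesis using s0 by (auto simp: Q_def)
  next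
    case False
    then have u2: "u = 2" "odd n" using u by auto
    have "odd q" using q2 q(1) prime_odd_nat by blast
    \<comment> \<open>Adding the odd \<open>q\<close> corrects the parity without changing the
      residue modulo \<open>q\<close>; as \<open>n\<close> is odd, \<open>s ^ 2 - n\<close> is then
      even too.\<close>
    define s where "s = (if odd s0 then s0 else s0 + int q)"
    have "odd s" using \<open>odd q\<close> by (simp add: s_def)
    then have "2 dvd s ^ 2 - int n" using u2 by simp
    moreover have "int q dvd s ^ 2 - int n"
    proof (cases "odd s0")
      case False
      have "int q dvd (s0 ^ 2 - int n) + int q * (2 * s0 + int q)" using s0 by (intro dvd_add) auto
      then show ?thesis using False by (simp add: s_def power2_eq_square algebra_simps)
    qed (use s0 in \<open>simp add: s_def\<close>)
    moreover have "coprime 2 (int q)" using \<open>odd q\<close> by simp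
    ultimately have "2 * int q dvd s ^ 2 - int n" by (intro divides_mult)
    then show ?thesis using u2 by (auto simp: Q_def)
  qed
  then obtain s where s: "Q dvd s ^ 2 - int n" by blast
  have "coprime n q" using prime_imp_coprime[OF q(1,3)] by (subst coprime_commute)
  then have "coprime n (u * q)" using u by (auto simp: coprime_commute)
  then have cop: "coprime (int n) Q" unfolding Q_def by (simp only: coprime_int_iff)
  have nonsq: "k ^ 2 \<noteq> Q" for k :: int
  proof
    assume k: "k ^ 2 = Q"
    have "prime (int q)" using q(1) by simp
    moreover have "int q dvd k ^ 2" unfolding k Q_def by simp
    ultimately have "int q dvd k" by (rule prime_dvd_power)
    then obtain j where "k = int q * j" by (elim dvdE)
    then have "int q * (int q * j ^ 2) = int q * int u"
      using k by (simp add: Q_def power2_eq_square algebra_simps)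
    then have "int q * j ^ 2 = int u" using q2 by (subst (asm) mult_cancel_left) auto
    then have "int q dvd int u" by (metis dvd_triv_left)
    then show False using q2 u by (auto dest: zdvd_imp_le)
  qed
  have "0 < Q" using q2 u by (auto simp: Q_def)
  then obtain W X T where W: "0 < W" "int n * W ^ 2 = X ^ 2 + Q * T ^ 2"
    using ternary_form_represents[OF _ _ cop s r nonsq] n0 by (metis of_nat_0_less_iff)
  obtain a b where ab: "int q = a ^ 2 + b ^ 2" using sum_two_squares_prime[OF q(1,2)] .
  have "\<exists>c d. Q = c ^ 2 + d ^ 2"
  proof (cases "u = 1")
    case False
    then have "Q = (a + b) ^ 2 + (a - b) ^ 2"
      using u ab by (simp add: Q_def power2_eq_square algebra_simps)
    then show ?thesis by blast
  qed (use ab in \<open>auto simp: Q_def\<close>)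
  then obtain c d where "Q = c ^ 2 + d ^ 2" by blast
  then have "int n * W ^ 2 = X ^ 2 + (c * T) ^ 2 + (d * T) ^ 2"
    using W(2) by (simp add: power_mult_distrib algebra_simps)
  then show ?thesis by (rule davenport_cassels[OF W(1)])
qed

lemma Legendre_prod:
  assumes "prime q" "2 < q" "finite P"
  shows "Legendre (int (\<Prod>P)) (int q) = (\<Prod>p\<in>P. Legendre (int p) (int q))"
  using assms(3) by (induction P) (use assms in \<open>auto simp: Legendre_mult Legendre_one\<close>)

lemma \<chi>4_prod: "finite P \<Longrightarrow> \<chi>4 (\<Prod>P) = (\<Prod>p\<in>P. \<chi>4 p)"
  by (induction P rule: finite_induct) (auto simp: \<chi>4_mult, simp add: \<chi>4_def)

lemma \<chi>8_prod: "finite P \<Longrightarrow> \<chi>8 (\<Prod>P) = (\<Prod>p\<in>P. \<chi>8 p)"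
  by (induction P rule: finite_induct) (auto simp: \<chi>8_mult, simp add: \<chi>8_def)

lemma Legendre_minus_1_eq_\<chi>4:
  assumes "prime p" "2 < p"
  shows "Legendre (-1) (int p) = \<chi>4 p"
proof -
  have "odd p" using assms prime_odd_nat by blast
  then have "p mod 4 = 1 \<or> p mod 4 = 3" by presburger
  then show ?thesis using Legendre_minus_1[OF assms] by (auto simp: \<chi>4_def)
qed

lemma Legendre_2_eq_\<chi>8:
  assumes "prime p" "2 < p"
  shows "Legendre 2 (int p) = \<chi>8 p"
proof -
  have "odd p" using assms prime_odd_nat by blast
  then have "p mod 8 = 1 \<or> p mod 8 = 3 \<or> p mod 8 = 5 \<or> p mod 8 = 7" by presburger
  then show ?thesis using Legendre_2[OF assms] by (auto simp: \<chi>8_def)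
qed

lemma Legendre_swap:
  assumes "prime p" "2 < p" "prime q" "q mod 4 = 1" "p \<noteq> q"
  shows "Legendre (int p) (int q) = Legendre (int q) (int p)"
proof -
  have "2 < q" using assms prime_ge_2_nat[of q] by (cases "q = 2") auto
  have "even ((q - 1) div 2)" using assms(4) by presburger
  then have "Legendre p q * Legendre q p = 1"
    using Quadratic_Reciprocity[OF assms(1,2,3) \<open>2 < q\<close> assms(5)] by simp
  then show ?thesis using Legendre_cases[of p q] Legendre_cases[of q p] by auto
qed

lemma three_squares_squarefree:
  fixes n :: nat
  assumes n: "squarefree n" and m: "n mod 4 = 1 \<or> n mod 4 = 2 \<or> n mod 8 = 3"
  shows "\<exists>x y z. int n = x ^ 2 + y ^ 2 + z ^ 2"
proof -
  have n0: "0 < n" using n by (cases "n = 0") auto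
  define P where "P = prime_factors n - {2}"
  have P: "finite P" "\<And>p. p \<in> P \<Longrightarrow> prime p \<and> 2 < p"
  proof -
    show "prime p \<and> 2 < p" if "p \<in> P" for p
    proof -
      have "prime p" "p \<noteq> 2" using that by (auto simp: P_def)
      then show ?thesis using prime_ge_2_nat[of p] by linarith
    qed
  qed (simp add: P_def)
  define m where "m = \<Prod>P"
  have nm: "n = (if even n then 2 * m else m)"
  proof (cases "even n")
    case True
    then have "2 \<in> prime_factors n" using n0 by (simp add: prime_factors_dvd)
    then have "\<Prod>(prime_factors n) = 2 * \<Prod>(prime_factors n - {2})"
      by (intro prod.remove) auto
    then show ?thesis using squarefree_eq_prod_prime_factors[OF n] True by (simp add: m_def P_def)
  next
    case False
    then have "P = prime_factors n" by (auto simp: P_def)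
    then show ?thesis using squarefree_eq_prod_prime_factors[OF n] False by (simp add: m_def)
  qed
  define u :: nat where "u = (if n mod 8 = 3 then 2 else 1)"
  \<comment> \<open>This is the symbol of \<open>- u\<close>; prescribing the same value for
    \<open>q\<close> makes \<open>- u * q\<close> a residue modulo \<open>p\<close>.\<close>
  define \<epsilon> where "\<epsilon> p = (if n mod 8 = 3 then \<chi>4 p * \<chi>8 p else \<chi>4 p)" for p
  have Leg_u: "Legendre (- int u) (int p) = \<epsilon> p" if "p \<in> P" for p
  proof -
    have p: "prime p" "2 < p" using P(2)[OF that] by auto
    have "Legendre (-1 * 2) (int p) = \<chi>4 p * \<chi>8 p"
      by (simp only: Legendre_mult[OF p] Legendre_minus_1_eq_\<chi>4[OF p] Legendre_2_eq_\<chi>8[OF p])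
    then show ?thesis using Legendre_minus_1_eq_\<chi>4[OF p] by (simp add: u_def \<epsilon>_def)
  qed
  have eps: "\<epsilon> p \<in> {-1, 1}" if "p \<in> P" for p
  proof -
    have "odd p" using P(2)[OF that] prime_odd_nat by blast
    then have "\<chi>4 p \<noteq> 0" "\<chi>8 p \<noteq> 0" unfolding \<chi>4_def \<chi>8_def by presburger+
    then have "\<epsilon> p \<noteq> 0" by (simp add: \<epsilon>_def)
    then show ?thesis using Legendre_cases[of "- int u" "int p"] Leg_u[OF that] by auto
  qed
  \<comment> \<open>For \<open>n = 2 * m\<close> the symbol of \<open>n\<close> modulo
    \<open>q\<close> is \<open>\<chi>8 q * \<chi>4 m\<close>, so this choice makes it 1. For odd
    \<open>n\<close> the value is arbitrary.\<close>
  define \<delta> where "\<delta> = (if even n then \<chi>4 m else 1)"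
  have "odd p" if "p \<in> P" for p using P(2)[OF that] prime_odd_nat[of p] by blast
  then have "odd m" unfolding m_def even_prod_iff[OF P(1)] by blast
  then have "m mod 4 = 1 \<or> m mod 4 = 3" by presburger
  then have "\<delta> \<in> {-1, 1}" by (auto simp: \<delta>_def \<chi>4_def)
  obtain q where q: "prime q" "q \<notin> P" "q mod 4 = 1" "\<chi>8 q = \<delta>"
    and Leg_q: "\<And>p. p \<in> P \<Longrightarrow> Legendre (int q) (int p) = \<epsilon> p"
    by (rule prime_with_prescribed_legendre[of P \<epsilon> \<delta>, OF P(1) _ _ \<open>\<delta> \<in> {-1, 1}\<close>])
      (use P(2) eps in blast)+
  have q2: "2 < q" using q prime_ge_2_nat[of q] by (cases "q = 2") auto
  show ?thesis
  proof (rule three_squares_via_prime[OF n q(1,3)])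
    show "\<not> q dvd n"
    proof
      assume "q dvd n"
      then have "q \<in> prime_factors n" using q(1) n0 by (simp add: prime_factors_dvd)
      then show False using q(2) q2 by (auto simp: P_def)
    qed
    show "u = 1 \<or> u = 2 \<and> odd n"
    proof -
      have "n mod 8 = 3 \<Longrightarrow> odd n" by presburger
      then show ?thesis by (simp add: u_def)
    qed
    show "Legendre (- int (u * q)) (int p) = 1" if p: "prime p" "2 < p" "p dvd n" for p
    proof -
      have "p \<in> P" using p n0 by (simp add: P_def prime_factors_dvd)
      then show ?thesis
        using Legendre_mult[OF p(1,2), of "- int u" "int q"] Leg_u[of p] Leg_q[of p] eps[of p]
        by fastforce
    qed
    have "Legendre (int m) (int q) = (\<Prod>p\<in>P. Legendre (int p) (int q))"
      unfolding m_def by (rule Legendre_prod[OF q(1) q2 P(1)])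
    also have "\<dots> = (\<Prod>p\<in>P. \<epsilon> p)"
    proof (rule prod.cong[OF refl])
      fix p assume p: "p \<in> P"
      then have "p \<noteq> q" using q(2) by blast
      then show "Legendre (int p) (int q) = \<epsilon> p"
        using Legendre_swap[of p q] P(2)[OF p] q(1,3) Leg_q[OF p] by simp
    qed
    also have "\<dots> = (if n mod 8 = 3 then \<chi>4 m * \<chi>8 m else \<chi>4 m)"
      by (simp add: \<epsilon>_def m_def \<chi>4_prod[OF P(1)] \<chi>8_prod[OF P(1)] prod.distrib)
    finally have Lm: "Legendre (int m) (int q) = (if n mod 8 = 3 then \<chi>4 m * \<chi>8 m else \<chi>4 m)" .
    show "Legendre (int n) (int q) = 1"
    proof (cases "even n")
      case True
      then have "n mod 8 \<noteq> 3" by presburger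
      then have "Legendre (int n) (int q) = \<chi>8 q * \<chi>4 m"
        using True nm Lm Legendre_mult[OF q(1) q2, of 2 "int m"] Legendre_2_eq_\<chi>8[OF q(1) q2] by simp
      then show ?thesis using q(4) True \<open>\<delta> \<in> {-1, 1}\<close> by (auto simp: \<delta>_def)
    next
      case False
      then have "n = m" using nm by simp
      have "n mod 4 = 1 \<or> n mod 8 = 3" using m False by presburger
      then show ?thesis
      proof
        assume "n mod 4 = 1"
        moreover from this have "n mod 8 \<noteq> 3" by presburger
        ultimately show ?thesis using Lm \<open>n = m\<close> by (simp add: \<chi>4_def)
      next
        assume "n mod 8 = 3"
        moreover from this have "n mod 4 = 3" by presburger
        ultimately show ?thesis using Lm \<open>n = m\<close> by (simp add: \<chi>4_def \<chi>8_def)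
      qed
    qed
  qed
qed

text \<open>Splitting off the largest square \<open>k ^ 2\<close> keeps the residue class: 4 does
  not divide \<open>n\<close>, so \<open>k\<close> is odd and \<open>k ^ 2\<close> is 1 modulo
  8.\<close>

theorem three_squares:
  fixes n :: int
  assumes "0 \<le> n" and m: "n mod 4 = 1 \<or> n mod 4 = 2 \<or> n mod 8 = 3"
  obtains x y z where "n = x ^ 2 + y ^ 2 + z ^ 2"
proof -
  define N where "N = nat n"
  have N: "int N = n" using assms by (simp add: N_def)
  have "n mod 4 = int (N mod 4)" "n mod 8 = int (N mod 8)" by (simp_all add: N zmod_int)
  then have mN: "N mod 4 = 1 \<or> N mod 4 = 2 \<or> N mod 8 = 3" using m by presburger
  define a k where "a = squarefree_part N" and "k = square_part N"
  have ak: "N = a * k ^ 2" unfolding a_def k_def by (rule squarefree_decompose)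
  have "odd k"
  proof
    assume "even k"
    then have "4 dvd k ^ 2" by (auto elim!: evenE simp: power_mult_distrib)
    then have "4 dvd N" unfolding ak by simp
    then show False using mN by presburger
  qed
  then have "k ^ 2 mod 8 = 1"
    using square_mod_8_eq_1_iff[of k] by (simp add: cong_def)
  then have "N mod 8 = a mod 8" unfolding ak by (metis mod_mult_right_eq mult.right_neutral)
  then have "a mod 4 = 1 \<or> a mod 4 = 2 \<or> a mod 8 = 3" using mN by presburger
  then obtain x y z where "int a = x ^ 2 + y ^ 2 + z ^ 2"
    using three_squares_squarefree[of a] by (auto simp: a_def)
  then have "n = (x * int k) ^ 2 + (y * int k) ^ 2 + (z * int k) ^ 2"
    unfolding N[symmetric] ak by (simp add: power_mult_distrib algebra_simps)
  then show ?thesis by (rule that)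
qed

section \<open>The representation theorems\<close>

lemma square_mod_3: "(x :: int) ^ 2 mod 3 = (if 3 dvd x then 0 else 1)"
proof -
  consider "x mod 3 = 0" | "x mod 3 = 1" | "x mod 3 = 2" by linarith
  then show ?thesis
    using power_mod[of x 3 2] by cases (auto simp: dvd_eq_mod_eq_0)
qed

lemma square_mod_4: "(x :: int) ^ 2 mod 4 = (if even x then 0 else 1)"
proof (cases "even x")
  case True
  then show ?thesis by (auto elim!: evenE simp: power_mult_distrib)
next
  case False
  then obtain k where "x = 2 * k + 1" by (elim oddE)
  then have "x ^ 2 = 1 + (k ^ 2 + k) * 4" by (simp add: power2_eq_square algebra_simps)
  then have "x ^ 2 mod 4 = 1 mod 4" by (simp only: mod_mult_self1)
  then show ?thesis using False by simp
qed

lemma mod_add3: "(a + b + c) mod m = (a mod m + b mod m + c mod m) mod (m :: int)"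
  by (metis mod_add_eq mod_mod_trivial)

lemma mod_8_cases:
  fixes m :: int
  shows "m mod 8 = 7 \<or> m mod 8 = 0 \<or> m mod 8 = 4 \<or> m mod 4 = 1 \<or> m mod 4 = 2 \<or> m mod 8 = 3"
  by presburger

lemma sum_three_squares_mod_4:
  fixes x y z :: int
  shows "(x ^ 2 + y ^ 2 + z ^ 2) mod 4 = (if even x then 0 else 1) + (if even y then 0 else 1) + (if even z then 0 else 1)"
proof -
  have "(x ^ 2 + y ^ 2 + z ^ 2) mod 4 = (x ^ 2 mod 4 + y ^ 2 mod 4 + z ^ 2 mod 4) mod 4"
    by (rule mod_add3)
  then show ?thesis unfolding square_mod_4 by simp
qed

lemma all_odd_of_sum_three_squares:
  fixes x y z :: int
  assumes "(x ^ 2 + y ^ 2 + z ^ 2) mod 4 = 3"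
  shows "odd x" "odd y" "odd z"
  using assms unfolding sum_three_squares_mod_4 by (simp_all split: if_splits)

lemma three_not_dvd_of_sum_three_squares:
  fixes x y z :: int
  assumes "3 dvd x ^ 2 + y ^ 2 + z ^ 2" "\<not> (3 dvd x \<and> 3 dvd y \<and> 3 dvd z)"
  shows "\<not> 3 dvd x" "\<not> 3 dvd y" "\<not> 3 dvd z"
proof -
  have "(x ^ 2 + y ^ 2 + z ^ 2) mod 3 = (x ^ 2 mod 3 + y ^ 2 mod 3 + z ^ 2 mod 3) mod 3"
    by (rule mod_add3)
  then have "((if 3 dvd x then 0 else 1) + (if 3 dvd y then 0 else 1) + (if 3 dvd z then 0 else 1)) mod 3 = (0 :: int)"
    using assms(1) unfolding square_mod_3 by simp
  then show "\<not> 3 dvd x" "\<not> 3 dvd y" "\<not> 3 dvd z"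
    using assms(2) by (simp_all split: if_splits)
qed

text \<open>Three times the reflection in the plane orthogonal to \<open>(1, 1, 1)\<close>.\<close>

lemma nine_times_reflection:
  fixes x y z :: int
  assumes "\<not> 3 dvd x + y + z"
  shows "\<exists>u v w. 9 * (x ^ 2 + y ^ 2 + z ^ 2) = u ^ 2 + v ^ 2 + w ^ 2 \<and> \<not> 3 dvd u \<and> \<not> 3 dvd v \<and> \<not> 3 dvd w"
proof (intro exI conjI)
  let ?s = "x + y + z"
  show "9 * (x ^ 2 + y ^ 2 + z ^ 2) = (3 * x - 2 * ?s) ^ 2 + (3 * y - 2 * ?s) ^ 2 + (3 * z - 2 * ?s) ^ 2"
    by (simp add: power2_eq_square algebra_simps)
  show "\<not> 3 dvd 3 * x - 2 * ?s" "\<not> 3 dvd 3 * y - 2 * ?s" "\<not> 3 dvd 3 * z - 2 * ?s"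
    using assms by presburger+
qed

text \<open>If 3 divides all roots, the induction hypothesis for \<open>M div 9\<close> already
  represents \<open>M\<close> with roots prime to 3. Once some root is prime to 3, a suitable choice
  of signs makes the sum of the roots prime to 3, and the reflection applies.\<close>

lemma nine_times_three_squares:
  fixes M x y z :: int
  assumes "0 < M" "M = x ^ 2 + y ^ 2 + z ^ 2"
  shows "\<exists>u v w. 9 * M = u ^ 2 + v ^ 2 + w ^ 2 \<and> \<not> 3 dvd u \<and> \<not> 3 dvd v \<and> \<not> 3 dvd w"
  using assms
proof (induction "nat M" arbitrary: M x y z rule: less_induct)
  case less
  have "\<exists>x y z. M = x ^ 2 + y ^ 2 + z ^ 2 \<and> \<not> (3 dvd x \<and> 3 dvd y \<and> 3 dvd z)"
  proof (cases "3 dvd x \<and> 3 dvd y \<and> 3 dvd z")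
    case True
    then obtain x' y' z' where "x = 3 * x'" "y = 3 * y'" "z = 3 * z'" by (auto elim!: dvdE)
    then have M: "M = 9 * (x' ^ 2 + y' ^ 2 + z' ^ 2)" using less.prems by (simp add: power_mult_distrib)
    then show ?thesis
      using less.hyps[of "x' ^ 2 + y' ^ 2 + z' ^ 2" x' y' z'] less.prems(1) by fastforce
  next
    case False
    then show ?thesis using less.prems by blast
  qed
  then obtain x y z where M: "M = x ^ 2 + y ^ 2 + z ^ 2" and nd: "\<not> (3 dvd x \<and> 3 dvd y \<and> 3 dvd z)"
    by blast
  from nd have "\<not> 3 dvd x + y + z \<or> \<not> 3 dvd x + y + - z \<or> \<not> 3 dvd x + - y + z \<or> \<not> 3 dvd - x + y + z"
    by presburger
  then show ?case
    using nine_times_reflection[of x y z] nine_times_reflection[of x y "- z"]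
      nine_times_reflection[of x "- y" z] nine_times_reflection[of "- x" y z]
    unfolding M power2_minus by blast
qed

text \<open>For a multiple of 3 either all roots or none are divisible by 3. In the first case
  \<open>N\<close> is 9 times a sum of three squares and can be represented anew.\<close>

lemma three_squares_not_dvd_3:
  fixes N :: int
  assumes "0 < N" "3 dvd N" "N mod 4 = 1 \<or> N mod 4 = 2 \<or> N mod 8 = 3"
  obtains x y z where "N = x ^ 2 + y ^ 2 + z ^ 2" "\<not> 3 dvd x" "\<not> 3 dvd y" "\<not> 3 dvd z"
proof -
  obtain x y z where N: "N = x ^ 2 + y ^ 2 + z ^ 2"
    using three_squares[of N] assms by auto
  show ?thesis
  proof (cases "3 dvd x \<and> 3 dvd y \<and> 3 dvd z")
    case True
    then obtain x' y' z' where "x = 3 * x'" "y = 3 * y'" "z = 3 * z'" by (auto elim!: dvdE)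
    then have "N = 9 * (x' ^ 2 + y' ^ 2 + z' ^ 2)" using N by (simp add: power_mult_distrib)
    then show ?thesis using nine_times_three_squares[OF _ refl, of x' y' z'] assms(1) that by auto
  next
    case False
    then show ?thesis
      using three_not_dvd_of_sum_three_squares[of x y z] assms(2) N that by blast
  qed
qed

lemma floor_div_sum_three_squares:
  fixes a :: int
  assumes "1 < a"
  shows "{\<lfloor>real_of_int (x^2 + y^2 + z^2) / real_of_int a\<rfloor> | x y z :: int. True} = \<nat>"
proof (intro equalityI subsetI)
  fix k assume "k \<in> {\<lfloor>real_of_int (x^2 + y^2 + z^2) / real_of_int a\<rfloor> | x y z :: int. True}"
  then obtain x y z :: int where "k = \<lfloor>real_of_int (x^2 + y^2 + z^2) / real_of_int a\<rfloor>" by blast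
  then have "0 \<le> k" using assms by simp
  then show "k \<in> \<nat>" by (metis int_nat_eq of_nat_in_Nats)
next
  fix k :: int assume "k \<in> \<nat>"
  then have k: "0 \<le> a * k" using assms by (auto elim!: Nats_cases)
  \<comment> \<open>The floor leaves the remainder \<open>r\<close> free. Any three consecutive
    integers contain an admissible one; for \<open>a = 2\<close> two must do, and the first is even,
    which suffices.\<close>
  have "\<exists>r. 0 \<le> r \<and> r < a \<and> ((a * k + r) mod 4 = 1 \<or> (a * k + r) mod 4 = 2 \<or> (a * k + r) mod 8 = 3)"
  proof (cases "a = 2")
    case True
    have "(2 * k) mod 4 = 2 \<or> (2 * k + 1) mod 4 = 1" by presburger
    then show ?thesis using True by (auto intro: exI[of _ 0] exI[of _ 1])
  next
    case False
    then have "2 < a" using assms by simp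
    let ?m = "a * k"
    consider "?m mod 8 = 7" | "?m mod 8 = 0" | "?m mod 8 = 4"
      | "?m mod 4 = 1 \<or> ?m mod 4 = 2 \<or> ?m mod 8 = 3"
      using mod_8_cases[of "?m"] by blast
    then show ?thesis
    proof cases
      case 1
      then have "(?m + 2) mod 4 = 1" by presburger
      then show ?thesis using \<open>2 < a\<close> by (intro exI[of _ 2]) simp
    next
      case 2
      then have "(?m + 1) mod 4 = 1" by presburger
      then show ?thesis using \<open>2 < a\<close> by (intro exI[of _ 1]) simp
    next
      case 3
      then have "(?m + 1) mod 4 = 1" by presburger
      then show ?thesis using \<open>2 < a\<close> by (intro exI[of _ 1]) simp
    next
      case 4
      then show ?thesis using \<open>2 < a\<close> by (intro exI[of _ 0]) simp
    qed
  qed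
  then obtain r where r: "0 \<le> r" "r < a"
    "(a * k + r) mod 4 = 1 \<or> (a * k + r) mod 4 = 2 \<or> (a * k + r) mod 8 = 3" by blast
  obtain x y z where xyz: "a * k + r = x ^ 2 + y ^ 2 + z ^ 2"
    using three_squares[OF _ r(3)] k r by auto
  have "\<lfloor>real_of_int (x^2 + y^2 + z^2) / real_of_int a\<rfloor> = (a * k + r) div a"
    by (simp only: xyz floor_divide_of_int_eq)
  also have "\<dots> = k" using r assms by simp
  finally show "k \<in> {\<lfloor>real_of_int (x^2 + y^2 + z^2) / real_of_int a\<rfloor> | x y z :: int. True}" by blast
qed

text \<open>Completing squares turns the claim into \<open>8 * m + 3\<close> as a sum of three odd
  squares, and the residue 3 modulo 4 forces the roots to be odd.\<close>

lemma three_triangular: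
  fixes m :: int
  assumes "0 \<le> m"
  obtains x y z where "2 * m = x * (x + 1) + y * (y + 1) + z * (z + 1)"
proof -
  have "(8 * m + 3) mod 8 = 3" by presburger
  then obtain X Y Z where e: "8 * m + 3 = X ^ 2 + Y ^ 2 + Z ^ 2"
    using three_squares[of "8 * m + 3"] assms by auto
  have "(8 * m + 3) mod 4 = 3" by presburger
  then have "odd X" "odd Y" "odd Z"
    using all_odd_of_sum_three_squares[of X Y Z] unfolding e by auto
  then obtain x y z where "X = 2 * x + 1" "Y = 2 * y + 1" "Z = 2 * z + 1" by (auto elim!: oddE)
  then have "2 * m = x * (x + 1) + y * (y + 1) + z * (z + 1)"
    using e by (simp add: power2_eq_square algebra_simps)
  then show ?thesis by (rule that)
qed

lemma floor_div_sum_three_triangular: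
  fixes a :: int
  assumes "1 < a"
  shows "{\<lfloor>real_of_int (x * (x + 1) + y * (y + 1) + z * (z + 1)) / real_of_int a\<rfloor>
    | x y z :: int. True} = \<nat>" (is "?S = _")
proof (intro equalityI subsetI)
  have nonneg: "0 \<le> x * (x + 1)" for x :: int
    by (cases "0 \<le> x") (auto intro: mult_nonpos_nonpos)
  fix k assume "k \<in> ?S"
  then obtain x y z where k: "k = \<lfloor>real_of_int (x * (x + 1) + y * (y + 1) + z * (z + 1)) / real_of_int a\<rfloor>"
    by blast
  have "0 \<le> real_of_int (x * (x + 1) + y * (y + 1) + z * (z + 1))"
    using nonneg[of x] nonneg[of y] nonneg[of z] by linarith
  then have "0 \<le> k" using assms unfolding k by simp
  then show "k \<in> \<nat>" by (metis int_nat_eq of_nat_in_Nats)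
next
  fix k :: int assume "k \<in> \<nat>"
  then have k: "0 \<le> a * k" using assms by (auto elim!: Nats_cases)
  \<comment> \<open>Round \<open>a * k\<close> up to an even number: the remainder is 0 or 1, and
    \<open>1 < a\<close> makes it harmless.\<close>
  define m where "m = (a * k + 1) div 2"
  define r where "r = 2 * m - a * k"
  have r: "0 \<le> r" "r < a" "2 * m = a * k + r" using assms by (auto simp: r_def m_def)
  have "0 \<le> m" using k by (simp add: m_def)
  then obtain x y z where xyz: "2 * m = x * (x + 1) + y * (y + 1) + z * (z + 1)"
    by (rule three_triangular)
  have "\<lfloor>real_of_int (x * (x + 1) + y * (y + 1) + z * (z + 1)) / real_of_int a\<rfloor> = (a * k + r) div a"
    by (simp only: xyz[symmetric] r(3) floor_divide_of_int_eq)
  also have "\<dots> = k" using r assms by simp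
  finally show "k \<in> ?S" by blast
qed

text \<open>As \<open>16 * x ^ 2 + 8 * a * x + a ^ 2 = (4 * x + a) ^ 2\<close>, it suffices to
  represent \<open>16 * n + 3 * a ^ 2\<close>, which is 3 modulo 8. Its odd roots are
  \<open>a\<close> modulo 4 up to sign, and the quantity under the floor comes out integral.\<close>

lemma three_squares_plus_floor_half:
  fixes a n :: int
  assumes "0 < a" "odd a" "0 \<le> n"
  shows "\<exists>x y z. n = x^2 + y^2 + z^2 + \<lfloor>real_of_int a / 2 * real_of_int (x + y + z)\<rfloor>"
proof -
  define N where "N = 16 * n + 3 * a ^ 2"
  obtain b where b: "a = 2 * b + 1" using assms(2) by (elim oddE)
  have "even (b * (b + 1))" by simp
  then obtain c where c: "b * (b + 1) = 2 * c" by (elim evenE)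
  have "a ^ 2 = 8 * c + 1" using c unfolding b by (simp add: power2_eq_square algebra_simps)
  then have N: "N mod 8 = 3" "N mod 4 = 3" unfolding N_def by presburger+
  obtain X Y Z where XYZ: "N = X ^ 2 + Y ^ 2 + Z ^ 2"
    using three_squares[of N] N assms by (auto simp: N_def)
  have lift: "\<exists>x. (4 * x + a) ^ 2 = W ^ 2" if "odd W" for W
  proof -
    have "4 dvd W - a \<or> 4 dvd - W - a" using that assms(2) by presburger
    then obtain x where "W - a = 4 * x \<or> - W - a = 4 * x" by (auto elim!: dvdE)
    then have "4 * x + a = W \<or> 4 * x + a = - W" by linarith
    then show ?thesis by (metis power2_minus)
  qed
  obtain x y z where "(4 * x + a) ^ 2 = X ^ 2" "(4 * y + a) ^ 2 = Y ^ 2" "(4 * z + a) ^ 2 = Z ^ 2"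
    using lift all_odd_of_sum_three_squares[of X Y Z] N(2) unfolding XYZ by metis
  then have "16 * n + 3 * a ^ 2 = (4 * x + a) ^ 2 + (4 * y + a) ^ 2 + (4 * z + a) ^ 2"
    using XYZ by (simp add: N_def)
  then have e: "a * (x + y + z) = 2 * (n - x^2 - y^2 - z^2)"
    by (simp add: power2_eq_square algebra_simps)
  have "\<lfloor>real_of_int a / 2 * real_of_int (x + y + z)\<rfloor> = \<lfloor>real_of_int (a * (x + y + z)) / real_of_int 2\<rfloor>"
    by simp
  also have "\<dots> = n - x^2 - y^2 - z^2"
    unfolding e floor_divide_of_int_eq by simp
  finally show ?thesis by (intro exI[of _ x] exI[of _ y] exI[of _ z]) simp
qed

text \<open>Completing squares needs the factor 36; the summand \<open>12 * r\<close> records the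
  remainder \<open>r\<close> of \<open>a * (x + y + z)\<close> modulo 3, which the floor discards.
  The freedom in \<open>r\<close> reaches a good class modulo 8, and \<open>\<not> 3 dvd a\<close>
  lets roots prime to 3 be written as required up to sign.\<close>

lemma three_squares_plus_floor_third:
  fixes a n :: int
  assumes "0 < a" "\<not> 3 dvd a" "0 \<le> n"
  shows "\<exists>x y z. n = x^2 + y^2 + z^2 + \<lfloor>real_of_int a / 3 * real_of_int (x + y + z)\<rfloor>"
proof -
  have "\<exists>x y z r. (r = 0 \<or> r = 1 \<or> r = 2) \<and>
    36 * n + 3 * a ^ 2 + 12 * r = (6 * x + a) ^ 2 + (6 * y + a) ^ 2 + (6 * z + a) ^ 2"
  proof (cases "even a")
    case False
    obtain b where b: "a = 2 * b + 1" using False by (elim oddE)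
    have "even (b * (b + 1))" by simp
    then obtain c where c: "b * (b + 1) = 2 * c" by (elim evenE)
    have a8: "a ^ 2 = 8 * c + 1" using c unfolding b by (simp add: power2_eq_square algebra_simps)
    \<comment> \<open>This makes \<open>n + r\<close> even, so that \<open>36 * n + 12 * r\<close>
      is divisible by 8 and \<open>N\<close> is 3 modulo 8.\<close>
    define r where "r = n mod 2"
    define N where "N = 36 * n + 3 * a ^ 2 + 12 * r"
    have r: "r = 0 \<or> r = 1" by (auto simp: r_def)
    have "N = 36 * n + 12 * r + 24 * c + 3" by (simp add: N_def a8)
    moreover have "even (n + r)" unfolding r_def by presburger
    ultimately have N: "N mod 8 = 3" "N mod 4 = 3" "3 dvd N" by presburger+
    have "0 < a ^ 2" using assms(1) by simp
    then have "0 < N" using r assms(3) unfolding N_def by linarith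
    obtain X Y Z where XYZ: "N = X ^ 2 + Y ^ 2 + Z ^ 2" "\<not> 3 dvd X" "\<not> 3 dvd Y" "\<not> 3 dvd Z"
      using three_squares_not_dvd_3[OF \<open>0 < N\<close> N(3)] N(1) by blast
    have lift: "\<exists>x. (6 * x + a) ^ 2 = W ^ 2" if "odd W" "\<not> 3 dvd W" for W
    proof -
      have "6 dvd W - a \<or> 6 dvd - W - a" using that False assms(2) by presburger
      then obtain x where "W - a = 6 * x \<or> - W - a = 6 * x" by (auto elim!: dvdE)
      then have "6 * x + a = W \<or> 6 * x + a = - W" by linarith
      then show ?thesis by (metis power2_minus)
    qed
    obtain x y z where "(6 * x + a) ^ 2 = X ^ 2" "(6 * y + a) ^ 2 = Y ^ 2" "(6 * z + a) ^ 2 = Z ^ 2"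
      using lift all_odd_of_sum_three_squares[of X Y Z] N(2) XYZ(2-4) unfolding XYZ(1) by metis
    then show ?thesis using XYZ(1) r unfolding N_def by metis
  next
    case True
    then obtain b where b: "a = 2 * b" by (elim evenE)
    have b3: "\<not> 3 dvd b" using assms(2) unfolding b by presburger
    \<comment> \<open>For even \<open>a\<close> everything is divisible by 4;
      \<open>m + 3 * r\<close> is the quotient.\<close>
    define m where "m = 9 * n + 3 * b ^ 2"
    have "\<exists>r. (r = 0 \<or> r = 1 \<or> r = 2) \<and>
      ((m + 3 * r) mod 4 = 1 \<or> (m + 3 * r) mod 4 = 2 \<or> (m + 3 * r) mod 8 = 3)"
    proof -
      consider "m mod 8 = 7" | "m mod 8 = 0" | "m mod 8 = 4"
        | "m mod 4 = 1 \<or> m mod 4 = 2 \<or> m mod 8 = 3"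
      using mod_8_cases[of "m"] by blast
      then show ?thesis
      proof cases
        case 1
        then have "(m + 3 * 1) mod 4 = 2" by presburger
        then show ?thesis by blast
      next
        case 2
        then have "(m + 3 * 1) mod 8 = 3" by presburger
        then show ?thesis by blast
      next
        case 3
        then have "(m + 3 * 2) mod 4 = 2" by presburger
        then show ?thesis by blast
      next
        case 4
        then show ?thesis by (intro exI[of _ 0]) simp
      qed
    qed
    then obtain r where r: "r = 0 \<or> r = 1 \<or> r = 2"
      "(m + 3 * r) mod 4 = 1 \<or> (m + 3 * r) mod 4 = 2 \<or> (m + 3 * r) mod 8 = 3" by blast
    have "0 < m + 3 * r"
    proof -
      have "0 < b ^ 2" using b assms(1) by simp
      then show ?thesis using r(1) assms(3) unfolding m_def by linarith
    qed
    moreover have "3 dvd m + 3 * r" unfolding m_def by presburger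
    ultimately obtain X Y Z where XYZ: "m + 3 * r = X ^ 2 + Y ^ 2 + Z ^ 2"
        "\<not> 3 dvd X" "\<not> 3 dvd Y" "\<not> 3 dvd Z"
      using three_squares_not_dvd_3 r(2) by blast
    have lift: "\<exists>x. (6 * x + a) ^ 2 = 4 * W ^ 2" if "\<not> 3 dvd W" for W
    proof -
      have "3 dvd W - b \<or> 3 dvd - W - b" using that b3 by presburger
      then obtain x where "W - b = 3 * x \<or> - W - b = 3 * x" by (auto elim!: dvdE)
      then have "6 * x + a = 2 * W \<or> 6 * x + a = 2 * (- W)" unfolding b by linarith
      then have "(6 * x + a) ^ 2 = 4 * W ^ 2" by (auto simp: power_mult_distrib)
      then show ?thesis by blast
    qed
    obtain x y z where "(6 * x + a) ^ 2 = 4 * X ^ 2" "(6 * y + a) ^ 2 = 4 * Y ^ 2" "(6 * z + a) ^ 2 = 4 * Z ^ 2"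
      using lift XYZ(2-4) by metis
    moreover have "36 * n + 3 * a ^ 2 + 12 * r = 4 * (m + 3 * r)"
      by (simp add: m_def b power_mult_distrib)
    ultimately have "36 * n + 3 * a ^ 2 + 12 * r = (6 * x + a) ^ 2 + (6 * y + a) ^ 2 + (6 * z + a) ^ 2"
      unfolding XYZ(1) by simp
    then show ?thesis using r(1) by blast
  qed
  then obtain x y z r where r: "r = 0 \<or> r = 1 \<or> r = 2" and
    "36 * n + 3 * a ^ 2 + 12 * r = (6 * x + a) ^ 2 + (6 * y + a) ^ 2 + (6 * z + a) ^ 2" by blast
  then have e: "a * (x + y + z) = 3 * (n - x^2 - y^2 - z^2) + r"
    by (simp add: power2_eq_square algebra_simps)
  have "\<lfloor>real_of_int a / 3 * real_of_int (x + y + z)\<rfloor> = \<lfloor>real_of_int (a * (x + y + z)) / real_of_int 3\<rfloor>"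
    by simp
  also have "\<dots> = (3 * (n - x^2 - y^2 - z^2) + r) div 3"
    unfolding e floor_divide_of_int_eq by simp
  also have "\<dots> = n - x^2 - y^2 - z^2" using r by auto
  finally show ?thesis by (intro exI[of _ x] exI[of _ y] exI[of _ z]) simp
qed

section \<open>Generalized octagonal numbers\<close>

lemma three_p8: "3 * p8 x + 1 = (3 * x - 1) ^ 2"
  by (simp add: p8_def power2_eq_square algebra_simps)

lemma p8_nonneg: "0 \<le> p8 x"
  unfolding p8_def by (cases "1 \<le> x") (auto intro: mult_nonpos_nonpos)

lemma ceiling_half_p8: "2 * \<lceil>real_of_int (p8 x) / 2\<rceil> = p8 x + x mod 2"
proof -
  have "even (p8 x) \<longleftrightarrow> even x" by (simp add: p8_def)
  then have "even (p8 x + x mod 2)" by presburger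
  then obtain k where k: "p8 x + x mod 2 = 2 * k" by (elim evenE)
  have "x mod 2 = 0 \<or> x mod 2 = 1" by presburger
  then have "\<lceil>real_of_int (p8 x) / 2\<rceil> = k"
  proof
    assume "x mod 2 = 0"
    then have "p8 x = 2 * k" using k by simp
    then show ?thesis by simp
  next
    assume "x mod 2 = 1"
    then have "real_of_int (p8 x) = 2 * real_of_int k - 1" using k by linarith
    then show ?thesis by (intro ceiling_unique) (simp_all add: field_simps)
  qed
  then show ?thesis using k by simp
qed

lemma octagonal_lift:
  assumes "\<not> 3 dvd X"
  obtains x where "X ^ 2 = 3 * p8 x + 1" "even x \<longleftrightarrow> odd X"
proof -
  have "3 dvd X + 1 \<or> 3 dvd - X + 1" using assms by presburger
  then obtain x where x: "X + 1 = 3 * x \<or> - X + 1 = 3 * x" by (auto elim!: dvdE)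
  then have "X = 3 * x - 1 \<or> X = - (3 * x - 1)" by linarith
  then have "X ^ 2 = 3 * p8 x + 1" unfolding three_p8 by (auto simp only: power2_minus)
  moreover have "even x \<longleftrightarrow> odd X" using x by presburger
  ultimately show ?thesis by (rule that)
qed

text \<open>Multiplied by 3, the equation asks for three squares with sum
  \<open>6 * n + 3 - 3 * k\<close>, where \<open>k\<close> counts the odd ones among
  \<open>y\<close> and \<open>z\<close>, and a root is even exactly when its index is odd. For odd
  \<open>n\<close> take \<open>6 * n\<close>, which is 2 modulo 4 and has one even root
  (\<open>k = 1\<close>); for even \<open>n\<close> take \<open>6 * n - 3\<close>, which is 1 modulo
  4 and has two (\<open>k = 2\<close>). Either way an odd root is left for the even
  \<open>x\<close>, whose \<open>p8 x / 2\<close> is its own ceiling.\<close>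

lemma octagonal_sum:
  fixes n :: int
  assumes "0 \<le> n"
  obtains x y z where "even x" "2 * n = p8 x + (p8 y + y mod 2) + (p8 z + z mod 2)"
proof -
  note witness = that
  consider "n = 0" | "odd n" | "0 < n" "even n" using assms by fastforce
  then show ?thesis
  proof cases
    case 1
    then show ?thesis using witness[of 0 0 0] by (simp add: p8_def)
  next
    case 2
    have "(6 * n) mod 4 = 2" using 2 by presburger
    moreover have "0 < 6 * n" using 2 assms by (cases "n = 0") auto
    ultimately obtain X Y Z where e: "6 * n = X ^ 2 + Y ^ 2 + Z ^ 2" "\<not> 3 dvd X" "\<not> 3 dvd Y" "\<not> 3 dvd Z"
      using three_squares_not_dvd_3[of "6 * n"] by auto
    have "(X ^ 2 + Y ^ 2 + Z ^ 2) mod 4 = 2" using \<open>(6 * n) mod 4 = 2\<close> e by simp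
    then have par: "even X \<and> odd Y \<and> odd Z \<or> odd X \<and> even Y \<and> odd Z \<or> odd X \<and> odd Y \<and> even Z"
      unfolding sum_three_squares_mod_4 by (simp split: if_splits)
    have go: ?thesis if h: "6 * n = U ^ 2 + V ^ 2 + W ^ 2" "\<not> 3 dvd U" "\<not> 3 dvd V" "\<not> 3 dvd W"
      "odd U" "even V" "odd W" for U V W
    proof -
      obtain x y z where "U ^ 2 = 3 * p8 x + 1" "V ^ 2 = 3 * p8 y + 1" "W ^ 2 = 3 * p8 z + 1"
        "even x" "odd y" "even z"
        using octagonal_lift h(2-7) by metis
      then show ?thesis using h(1) by (intro witness[of x y z]) (auto simp: odd_iff_mod_2_eq_one even_iff_mod_2_eq_zero)
    qed
    show ?thesis using par e go[of X Y Z] go[of Y X Z] go[of X Z Y] by (auto simp: add_ac)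
  next
    case 3
    have "(6 * n - 3) mod 4 = 1" "3 dvd 6 * n - 3" using 3 by presburger+
    moreover have "0 < 6 * n - 3" using 3 by simp
    ultimately obtain X Y Z where e: "6 * n - 3 = X ^ 2 + Y ^ 2 + Z ^ 2" "\<not> 3 dvd X" "\<not> 3 dvd Y" "\<not> 3 dvd Z"
      using three_squares_not_dvd_3[of "6 * n - 3"] by blast
    have "(X ^ 2 + Y ^ 2 + Z ^ 2) mod 4 = 1" using \<open>(6 * n - 3) mod 4 = 1\<close> e by simp
    then have par: "odd X \<and> even Y \<and> even Z \<or> even X \<and> odd Y \<and> even Z \<or> even X \<and> even Y \<and> odd Z"
      unfolding sum_three_squares_mod_4 by (simp split: if_splits)
    have go: ?thesis if h: "6 * n - 3 = U ^ 2 + V ^ 2 + W ^ 2" "\<not> 3 dvd U" "\<not> 3 dvd V" "\<not> 3 dvd W"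
      "odd U" "even V" "even W" for U V W
    proof -
      obtain x y z where "U ^ 2 = 3 * p8 x + 1" "V ^ 2 = 3 * p8 y + 1" "W ^ 2 = 3 * p8 z + 1"
        "even x" "odd y" "odd z"
        using octagonal_lift h(2-7) by metis
      then show ?thesis using h(1) by (intro witness[of x y z]) (auto simp: odd_iff_mod_2_eq_one)
    qed
    show ?thesis using par e go[of X Y Z] go[of Y X Z] go[of Z X Y] by (auto simp: add_ac)
  qed
qed

lemma half_octagonal_representation:
  fixes n :: nat
  shows "\<exists>x y z. real n = real_of_int (p8 x) / 2 + real_of_int \<lceil>real_of_int (p8 y) / 2\<rceil>
    + real_of_int \<lceil>real_of_int (p8 z) / 2\<rceil>"
proof -
  obtain x y z where "even x" "2 * int n = p8 x + (p8 y + y mod 2) + (p8 z + z mod 2)"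
    by (rule octagonal_sum[of "int n"]) simp
  from this(2) have "2 * int n = p8 x + 2 * \<lceil>real_of_int (p8 y) / 2\<rceil> + 2 * \<lceil>real_of_int (p8 z) / 2\<rceil>"
    unfolding ceiling_half_p8 .
  then have "real_of_int (2 * int n) = real_of_int (p8 x + 2 * \<lceil>real_of_int (p8 y) / 2\<rceil> + 2 * \<lceil>real_of_int (p8 z) / 2\<rceil>)"
    by simp
  then show ?thesis by (intro exI[of _ x] exI[of _ y] exI[of _ z]) simp
qed

lemma s_eq: "s x = x + \<lceil>3 / 2 * (real_of_int x)^2\<rceil>"
proof -
  have "real_of_int (p8 (- x)) / 2 = 3 / 2 * (real_of_int x)^2 + real_of_int x"
    by (simp add: p8_def power2_eq_square field_simps)
  then have "s x = \<lceil>3 / 2 * (real_of_int x)^2 + real_of_int x\<rceil>" by (simp only: s_def)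
  also have "\<dots> = \<lceil>3 / 2 * (real_of_int x)^2\<rceil> + x" by (rule ceiling_add_of_int)
  finally show ?thesis by (simp only: add.commute)
qed

lemma two_s_minus: "2 * s (- x) = p8 x + x mod 2"
  using ceiling_half_p8[of x] by (simp only: s_def minus_minus)

lemma range_s_sum: "{s x + s y + s z | x y z :: int. True} = \<nat>"
proof (intro equalityI subsetI)
  fix k assume "k \<in> {s x + s y + s z | x y z :: int. True}"
  moreover have "0 \<le> s x" for x
    unfolding s_def using p8_nonneg[of "- x"] by (simp add: le_ceiling_iff less_le_trans[of "-1" 0])
  ultimately have "0 \<le> k" by auto
  then show "k \<in> \<nat>" by (metis int_nat_eq of_nat_in_Nats)
next
  fix k :: int assume "k \<in> \<nat>"
  then have "0 \<le> k" by (auto elim!: Nats_cases)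
  then obtain x y z where e: "even x" "2 * k = p8 x + (p8 y + y mod 2) + (p8 z + z mod 2)"
    by (rule octagonal_sum)
  then have "2 * k = 2 * s (- x) + 2 * s (- y) + 2 * s (- z)"
    using two_s_minus[of x] two_s_minus[of y] two_s_minus[of z] by simp
  then have "k = s (- x) + s (- y) + s (- z)" by simp
  then show "k \<in> {s x + s y + s z | x y z :: int. True}" by blast
qed

theorem theorem1p4:
  shows
    "(\<forall>a::int. a > 1 \<longrightarrow>
        {\<lfloor>real_of_int (x^2 + y^2 + z^2) / real_of_int a\<rfloor> | x y z :: int. True} = \<nat> \<and>
        {\<lfloor>real_of_int (x * (x + 1) + y * (y + 1) + z * (z + 1)) / real_of_int a\<rfloor>
          | x y z :: int. True} = \<nat>)
     \<and>
     (\<forall>a::int. a > 0 \<longrightarrow>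
        (odd a \<longrightarrow> (\<forall>n::nat. \<exists>x y z :: int.
           int n = x^2 + y^2 + z^2 + \<lfloor>real_of_int a / 2 * real_of_int (x + y + z)\<rfloor>)) \<and>
        (\<not> 3 dvd a \<longrightarrow> (\<forall>n::nat. \<exists>x y z :: int.
           int n = x^2 + y^2 + z^2 + \<lfloor>real_of_int a / 3 * real_of_int (x + y + z)\<rfloor>)))
     \<and>
     (\<forall>n::nat. \<exists>x y z :: int.
        real n = real_of_int (p8 x) / 2 + real_of_int \<lceil>real_of_int (p8 y) / 2\<rceil>
                 + real_of_int \<lceil>real_of_int (p8 z) / 2\<rceil>)
     \<and>
     (\<forall>x::int. s x = x + \<lceil>3 / 2 * (real_of_int x)^2\<rceil>)
     \<and>
     {s x + s y + s z | x y z :: int. True} = \<nat>"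
  using floor_div_sum_three_squares floor_div_sum_three_triangular
    three_squares_plus_floor_half three_squares_plus_floor_third
    half_octagonal_representation s_eq range_s_sum
  by (intro conjI allI impI) simp_all

end
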